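(* In the secretary matching problem with vertex arrival (setting in the context), no online algorithm has a competitive ratio better than $\frac{5}{12}$: for every online algorithm (possibly randomized, defined for every number $n$ of vertices) and every $\varepsilon>0$, there exist $n$ and a complete graph on $n$ vertices with nonnegative edge weights such that the expected weight of the matching produced by the algorithm is less than $\left(\frac{5}{12}+\varepsilon\right)$ times the weight of a maximum weight matching.
   Context: Setting (secretary matching with vertex arrival): $G=(V,E)$ is a complete graph on $n$ vertices with edge weights $w_e\ge 0$ unknown in advance; $n$ is known to the algorithm. The vertices arrive in a uniformly random order $v_1,\dots,v_n$. When $v_t$ arrives, the weights of its edges to $v_1,\dots,v_{t-1}$ are revealed, and the online algorithm must immediately and irrevocably either match $v_t$ to one currently unmatched earlier vertex or leave $v_t$ unmatched for now (an unmatched vertex may later be matched by a later-arriving vertex). Its decisions may depend only on the information revealed so far and on internal randomness. The expectation is over the arrival order and the algorithm's randomness. An algorithm has competitive ratio $\alpha$ if on every instance its expected matching weight is at least $\alpha$ times the maximum matching weight. *)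

theory Defs
  imports "HOL-Probability.Probability" "HOL-Combinatorics.Multiset_Permutations"
begin

definition complete_edges :: "nat \<Rightarrow> nat set set" where
  "complete_edges n = {e. e \<subseteq> {..<n} \<and> card e = 2}"

definition is_matching :: "nat \<Rightarrow> nat set set \<Rightarrow> bool" where
  "is_matching n M \<longleftrightarrow> M \<subseteq> complete_edges n \<and> pairwise disjnt M"

definition max_matching_weight :: "nat \<Rightarrow> (nat set \<Rightarrow> real) \<Rightarrow> real" where
  "max_matching_weight n w = Max {sum w M | M. is_matching n M}"

definition revealed :: "(nat set \<Rightarrow> real) \<Rightarrow> nat list \<Rightarrow> nat set \<Rightarrow> real" where
  "revealed w vs = restrict w {e. e \<subseteq> set vs \<and> card e = 2}"

text \<open>
  A decision rule is applied, whenever a vertex arrives, to the list of all vertices that have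
  arrived so far (in order of arrival, the last entry being the new vertex) and the weights
  revealed so far. The answer \<open>Some u\<close> requests that the new vertex be matched to \<open>u\<close>; the answer
  \<open>None\<close> leaves it unmatched for now. The current matching need not be an argument, as it is
  determined by the rule itself and the data revealed so far.
\<close>

type_synonym decision_rule = "nat list \<Rightarrow> (nat set \<Rightarrow> real) \<Rightarrow> nat option"

text \<open>
  The matching after the first \<open>t\<close> arrivals of the arrival order \<open>vs\<close>. A request for a vertex
  that has not arrived earlier or is already matched leaves the new vertex unmatched, so that
  every decision rule produces a matching.
\<close>

primrec online_matching ::
  "decision_rule \<Rightarrow> (nat set \<Rightarrow> real) \<Rightarrow> nat list \<Rightarrow> nat \<Rightarrow> nat set set" where
  "online_matching D w vs 0 = {}"
| "online_matching D w vs (Suc t) =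
    (let M = online_matching D w vs t
     in case D (take (Suc t) vs) (revealed w (take (Suc t) vs)) of
          None \<Rightarrow> M
        | Some u \<Rightarrow> if u \<in> set (take t vs) - \<Union>M then insert {u, vs ! t} M else M)"

text \<open>
  A randomized algorithm draws a random seed from a probability space \<open>R\<close> and then follows the
  decision rule \<open>A n r\<close>, where \<open>n\<close> is the number of vertices and \<open>r\<close> is the seed.
\<close>

definition online_algorithm ::
  "'r measure \<Rightarrow> (nat \<Rightarrow> 'r \<Rightarrow> decision_rule) \<Rightarrow> bool" where
  "online_algorithm R A \<longleftrightarrow>
     prob_space R \<and>
     (\<forall>n vs f. (\<lambda>r. A n r vs f) \<in> measurable R (count_space UNIV))"

text \<open>
  The seed is independent of the arrival order, hence the iterated expectation.
\<close>

definition expected_weight ::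
  "'r measure \<Rightarrow> (nat \<Rightarrow> 'r \<Rightarrow> decision_rule) \<Rightarrow> nat \<Rightarrow> (nat set \<Rightarrow> real) \<Rightarrow> real" where
  "expected_weight R A n w =
     measure_pmf.expectation (pmf_of_set (permutations_of_set {..<n}))
       (\<lambda>vs. \<integral>r. sum w (online_matching (A n r) w vs n) \<partial>R)"

end

theory Submission
  imports Defs "HOL-Library.Ramsey"
begin

text \<open>
  The vertices carry distinct natural numbers as values and an edge weighs \<open>C\<close> to the sum of the
  values of its endpoints, for a large \<open>C\<close>; thus only matching the two vertices of largest value
  to each other counts. By Ramsey's theorem the values can be chosen such that they carry almost
  no information beyond their relative order. For relative orders, the edge between the two
  largest values among the first \<open>t\<close> arrivals always joins the new vertex to the previous record
  holder if it is new (probability \<open>2/t\<close>), so all that matters is whether the record holder is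
  still free. If \<open>k t\<close> is the probability of this and \<open>h t\<close> that of taking such an edge at time
  \<open>t\<close>, then \<open>k t \<le> 1/t + (1 - 1/t) k (t-1) - h t\<close> and \<open>h t \<le> 2 k (t-1) / t\<close>, and the
  gain is the sum of \<open>t (t-1) / (n (n-1)) h t\<close>. The optimum of this linear program, attained by
  accepting from time \<open>n/2\<close> on, tends to \<open>5/12\<close>.
\<close>

section \<open>Homogeneous sets and averages over permutations\<close>

text \<open>Rounding \<open>f\<close> down to a multiple of \<open>\<delta>\<close> colours the
  \<open>t\<close>-subsets with finitely many colours, so Ramsey's theorem yields an infinite
  homogeneous subset. The sizes \<open>t = 0, ..., n\<close> are treated in turn, shrinking the set
  each time; \<open>c t\<close> is the lower end of the interval that survives for size
  \<open>t\<close>.\<close>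

lemma Ramsey_almost_constant:
  fixes f :: "'a set \<Rightarrow> real"
  assumes "infinite Z" "\<delta> > 0"
    and f01: "\<And>T. 0 \<le> f T" "\<And>T. f T \<le> 1"
  shows "\<exists>Y\<subseteq>Z. infinite Y \<and> (\<exists>c. \<forall>t\<le>n. 0 \<le> c t \<and>
           (\<forall>T\<subseteq>Y. finite T \<and> card T = t \<longrightarrow> c t \<le> f T \<and> f T \<le> c t + \<delta>))"
proof (induction n)
  have step: "\<exists>Y'\<subseteq>Y. infinite Y' \<and> (\<exists>c\<ge>0.
      \<forall>T\<subseteq>Y'. finite T \<and> card T = t \<longrightarrow> c \<le> f T \<and> f T \<le> c + \<delta>)"
    if Y: "infinite Y" for Y :: "'a set" and t
  proof -
    have "nat \<lfloor>f X / \<delta>\<rfloor> < Suc (nat \<lfloor>1 / \<delta>\<rfloor>)" for X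
      using f01[of X] \<open>\<delta> > 0\<close>
      by (auto simp: less_Suc_eq_le intro!: nat_mono floor_mono divide_right_mono)
    hence "\<forall>X. X \<subseteq> Y \<and> finite X \<and> card X = t \<longrightarrow> nat \<lfloor>f X / \<delta>\<rfloor> < Suc (nat \<lfloor>1 / \<delta>\<rfloor>)"
      by simp
    from Ramsey[OF Y this] obtain Y' i where Y': "Y' \<subseteq> Y" "infinite Y'"
      and i: "\<And>X. X \<subseteq> Y' \<Longrightarrow> finite X \<Longrightarrow> card X = t \<Longrightarrow> nat \<lfloor>f X / \<delta>\<rfloor> = i"
      by metis
    have "real i * \<delta> \<le> f T \<and> f T \<le> real i * \<delta> + \<delta>"
      if "T \<subseteq> Y'" "finite T" "card T = t" for T
    proof -
      have "0 \<le> f T / \<delta>" using f01 \<open>\<delta> > 0\<close> by simp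
      hence "real i = of_int \<lfloor>f T / \<delta>\<rfloor>"
        using i that by (metis of_nat_nat zero_le_floor of_int_of_nat_eq)
      hence "real i \<le> f T / \<delta>" "f T / \<delta> < real i + 1"
        by linarith+
      thus ?thesis using \<open>\<delta> > 0\<close> by (simp add: field_simps)
    qed
    moreover have "0 \<le> real i * \<delta>" using \<open>\<delta> > 0\<close> by simp
    ultimately show ?thesis
      using Y' by (intro exI[of _ Y'] conjI exI[of _ "real i * \<delta>"]) simp_all
  qed
  {
    case 0
    from step[OF assms(1), of 0] obtain Y c where Y: "Y \<subseteq> Z" "infinite Y" "c \<ge> 0"
      and c: "\<forall>T\<subseteq>Y. finite T \<and> card T = 0 \<longrightarrow> c \<le> f T \<and> f T \<le> c + \<delta>"
      by (elim exE conjE)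
    have "\<forall>t\<le>0. 0 \<le> c \<and> (\<forall>T\<subseteq>Y. finite T \<and> card T = t \<longrightarrow> c \<le> f T \<and> f T \<le> c + \<delta>)"
      using Y(3) c by (intro allI impI) (simp only: le_zero_eq simp_thms)
    with Y(1,2) show ?case by (intro exI[of _ Y] conjI exI[of _ "\<lambda>_. c"])
  next
    case (Suc n)
    then obtain Y c where Y: "Y \<subseteq> Z" "infinite Y"
      and c: "\<forall>t\<le>n. 0 \<le> c t \<and>
           (\<forall>T\<subseteq>Y. finite T \<and> card T = t \<longrightarrow> c t \<le> f T \<and> f T \<le> c t + \<delta>)"
      by (elim exE conjE)
    from step[OF Y(2), of "Suc n"] obtain Y' c' where Y': "Y' \<subseteq> Y" "infinite Y'" "c' \<ge> 0"
      and c': "\<forall>T\<subseteq>Y'. finite T \<and> card T = Suc n \<longrightarrow> c' \<le> f T \<and> f T \<le> c' + \<delta>"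
      by (elim exE conjE)
    have "0 \<le> (c(Suc n := c')) t" if "t \<le> Suc n" for t
      using that c Y'(3) by (cases "t = Suc n") simp_all
    moreover have "(c(Suc n := c')) t \<le> f T \<and> f T \<le> (c(Suc n := c')) t + \<delta>"
      if "t \<le> Suc n" "T \<subseteq> Y'" "finite T" "card T = t" for t T
    proof (cases "t = Suc n")
      case True
      thus ?thesis using c' that by simp
    next
      case False
      hence "t \<le> n" "T \<subseteq> Y" using that Y'(1) by auto
      thus ?thesis using c that False by simp
    qed
    ultimately have "\<forall>t\<le>Suc n. 0 \<le> (c(Suc n := c')) t \<and> (\<forall>T\<subseteq>Y'. finite T \<and> card T = t \<longrightarrow>
        (c(Suc n := c')) t \<le> f T \<and> f T \<le> (c(Suc n := c')) t + \<delta>)"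
      by (intro allI impI conjI) auto
    with Y(1) Y'(1,2) show ?case
      by (intro exI[of _ Y'] conjI exI[of _ "c(Suc n := c')"]) (rule subset_trans)
  }
qed

section \<open>Averages over all orders of a finite set\<close>

definition perm_average :: "('a list \<Rightarrow> real) \<Rightarrow> 'a set \<Rightarrow> real" where
  "perm_average f T = (\<Sum>ys\<in>permutations_of_set T. f ys) / fact (card T)"

text \<open>Conditioning on the last entry. Since \<open>permutations_of_set_nonempty\<close> splits
  off the first entry, both sums are reversed, which is harmless because \<open>rev\<close> permutes
  the permutations of a set.\<close>

lemma sum_permutations_of_set_snoc:
  assumes "T \<noteq> {}"
  shows "(\<Sum>ys\<in>permutations_of_set T. f ys) =
         (\<Sum>x\<in>T. \<Sum>zs\<in>permutations_of_set (T - {x}). f (zs @ [x]))"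
proof (cases "finite T")
  case True
  have rev: "(\<Sum>ys\<in>permutations_of_set A. g ys) = (\<Sum>ys\<in>permutations_of_set A. g (rev ys))"
    for g and A :: "'a set"
    using sum.reindex[of rev "permutations_of_set A" g]
    by (simp add: comp_def)
  have "(\<Sum>ys\<in>permutations_of_set T. f (rev ys)) =
        (\<Sum>x\<in>T. \<Sum>zs\<in>permutations_of_set (T - {x}). f (rev (x # zs)))"
    unfolding permutations_of_set_nonempty[OF assms] using True
    by (subst sum.UNION_disjoint) (auto simp: sum.reindex)
  thus ?thesis
    by (subst rev, subst (2) rev) simp
qed (simp add: permutations_of_set_infinite)

text \<open>The last arrival is uniform in \<open>T\<close>, and given it the others come in
  uniformly random order.\<close>

lemma perm_average_snoc:
  assumes "finite T" "T \<noteq> {}"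
  shows "perm_average f T = (\<Sum>x\<in>T. perm_average (\<lambda>zs. f (zs @ [x])) (T - {x})) / card T"
proof -
  obtain k where k: "card T = Suc k" using assms by (cases "card T") auto
  have "(\<Sum>x\<in>T. perm_average (\<lambda>zs. f (zs @ [x])) (T - {x})) =
    (\<Sum>x\<in>T. (\<Sum>zs\<in>permutations_of_set (T - {x}). f (zs @ [x])) / fact k)"
    unfolding perm_average_def using k assms by (intro sum.cong) auto
  also have "\<dots> = (\<Sum>ys\<in>permutations_of_set T. f ys) / fact k"
    by (simp add: sum_permutations_of_set_snoc[OF assms(2)] sum_divide_distrib)
  also have "\<dots> = perm_average f T * card T"
    by (simp add: perm_average_def k)
  finally show ?thesis by (simp add: k)
qed

lemma perm_average_mono:
  assumes "\<And>ys. ys \<in> permutations_of_set T \<Longrightarrow> f ys \<le> g ys"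
  shows "perm_average f T \<le> perm_average g T"
  unfolding perm_average_def using assms by (intro divide_right_mono sum_mono) auto

lemma perm_average_add: "perm_average (\<lambda>ys. f ys + g ys) T = perm_average f T + perm_average g T"
  by (simp add: perm_average_def sum.distrib add_divide_distrib)

lemma perm_average_const: "finite T \<Longrightarrow> perm_average (\<lambda>_. c) T = c"
  by (simp add: perm_average_def)

section \<open>The record game\<close>

definition largest :: "nat set \<Rightarrow> nat" where
  "largest T = Max T"

definition second_largest :: "nat set \<Rightarrow> nat" where
  "second_largest T = Max (T - {Max T})"

lemma largest_second_largest:
  assumes "finite T" "card T \<ge> 2"
  shows "largest T \<in> T" "second_largest T \<in> T" "second_largest T < largest T"
    "\<And>x. x \<in> T \<Longrightarrow> x \<le> largest T"
    "\<And>x. x \<in> T \<Longrightarrow> x \<noteq> largest T \<Longrightarrow> x \<le> second_largest T"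
proof -
  have ne: "T \<noteq> {}" using assms by auto
  have "card (T - {Max T}) \<ge> 1" using assms ne by simp
  hence ne': "T - {Max T} \<noteq> {}" by force
  have "Max (T - {Max T}) \<in> T - {Max T}" using ne' assms by (intro Max_in) auto
  thus "largest T \<in> T" "second_largest T \<in> T" "second_largest T < largest T"
    using assms ne unfolding largest_def second_largest_def by (auto simp: less_le)
qed (use assms in \<open>auto simp: largest_def second_largest_def\<close>)

text \<open>
  \<open>F ys\<close> stands for the probability that the largest value is unmatched, \<open>W ys\<close> for the
  probability that the two largest values are matched to each other, after values have arrived in
  the order \<open>ys\<close>.
\<close>

locale top_two_game =
  fixes n :: nat and F W :: "nat list \<Rightarrow> real"
  assumes F_nonneg: "0 \<le> F ys" and F_le_1: "F ys \<le> 1"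
    and W_nonneg: "0 \<le> W ys" and W_le_1: "W ys \<le> 1"
    and new_largest: "\<lbrakk>distinct (zs @ [x]); zs \<noteq> []; length zs < n; x = largest (set (zs @ [x]))\<rbrakk>
      \<Longrightarrow> F (zs @ [x]) + W (zs @ [x]) \<le> 1 \<and> W (zs @ [x]) \<le> F zs"
    and new_second: "\<lbrakk>distinct (zs @ [x]); zs \<noteq> []; length zs < n; x = second_largest (set (zs @ [x]))\<rbrakk>
      \<Longrightarrow> F (zs @ [x]) + W (zs @ [x]) \<le> F zs"
    and new_other: "\<lbrakk>distinct (zs @ [x]); zs \<noteq> []; length zs < n;
      x \<notin> {largest (set (zs @ [x])), second_largest (set (zs @ [x]))}\<rbrakk>
      \<Longrightarrow> F (zs @ [x]) \<le> F zs \<and> W (zs @ [x]) \<le> W zs"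
begin

text \<open>The part of \<open>W\<close> earned by the last arrival: if the newcomer is one of the
  two largest, their edge did not exist before, otherwise a win is inherited. Averages of
  \<open>G\<close> play the role of \<open>h t\<close> in the linear program.\<close>

definition G :: "nat list \<Rightarrow> real" where
  "G ys = (if last ys \<in> {largest (set ys), second_largest (set ys)} then W ys else 0)"

lemma G_bounds: "0 \<le> G ys" "G ys \<le> 1"
  using W_nonneg W_le_1 by (auto simp: G_def)

context
  fixes T :: "nat set"
  assumes T: "finite T" "card T \<ge> 2" "card T \<le> n"
begin

lemma snoc_of_perm:
  assumes "x \<in> T" "zs \<in> permutations_of_set (T - {x})"
  shows "distinct (zs @ [x])" "zs \<noteq> []" "length zs < n" "set (zs @ [x]) = T"
proof -
  have zs: "set zs = T - {x}" "distinct zs" using assms by (auto simp: permutations_of_set_def)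
  have "length zs = card T - 1" using zs distinct_card[of zs] assms T by simp
  thus "zs \<noteq> []" "length zs < n" using T by auto
  show "distinct (zs @ [x])" using zs by simp
  show "set (zs @ [x]) = T" using zs assms(1) by (simp add: insert_absorb)
qed

text \<open>Condition on the last arrival \<open>x\<close>. A new record leaves \<open>F + G\<close>
  at most 1; the second largest gives \<open>F + G \<le> F zs\<close>; for every other
  \<open>x\<close>, \<open>G\<close> vanishes and \<open>F\<close> does not increase.\<close>

lemma average_F_le:
  "perm_average F T \<le> (1 + (\<Sum>x\<in>T - {largest T}. perm_average F (T - {x}))) / card T - perm_average G T"
proof -
  note lT = largest_second_largest[OF T(1,2)]
  have "perm_average F T + perm_average G T = perm_average (\<lambda>ys. F ys + G ys) T"
    by (simp add: perm_average_add)
  also have "\<dots> = (\<Sum>x\<in>T. perm_average (\<lambda>zs. F (zs @ [x]) + G (zs @ [x])) (T - {x})) / card T"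
    using T by (intro perm_average_snoc) auto
  also have "\<dots> \<le> (\<Sum>x\<in>T. if x = largest T then 1 else perm_average F (T - {x})) / card T"
  proof (intro divide_right_mono sum_mono)
    fix x assume x: "x \<in> T"
    show "perm_average (\<lambda>zs. F (zs @ [x]) + G (zs @ [x])) (T - {x}) \<le>
          (if x = largest T then 1 else perm_average F (T - {x}))"
    proof (cases "x = largest T")
      case True
      have "perm_average (\<lambda>zs. F (zs @ [x]) + G (zs @ [x])) (T - {x}) \<le>
            perm_average (\<lambda>_. 1) (T - {x})"
      proof (rule perm_average_mono)
        fix zs assume "zs \<in> permutations_of_set (T - {x})"
        note s = snoc_of_perm[OF x this]
        show "F (zs @ [x]) + G (zs @ [x]) \<le> 1"
          using new_largest[OF s(1-3)] True unfolding G_def s(4) by simp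
      qed
      thus ?thesis using T True by (simp add: perm_average_const)
    next
      case False
      have "perm_average (\<lambda>zs. F (zs @ [x]) + G (zs @ [x])) (T - {x}) \<le> perm_average F (T - {x})"
      proof (rule perm_average_mono)
        fix zs assume "zs \<in> permutations_of_set (T - {x})"
        note s = snoc_of_perm[OF x this]
        show "F (zs @ [x]) + G (zs @ [x]) \<le> F zs"
          using new_second[OF s(1-3)] new_other[OF s(1-3)] False unfolding G_def s(4) by auto
      qed
      thus ?thesis using False by simp
    qed
  qed simp
  also have "(\<Sum>x\<in>T. if x = largest T then 1 else perm_average F (T - {x})) =
             1 + (\<Sum>x\<in>T - {largest T}. perm_average F (T - {x}))"
    using T lT by (subst sum.remove[of _ "largest T"]) auto
  finally show ?thesis by simp
qed

text \<open>A newcomer among the top two can win only if the previous record holder was free, so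
  each of these two cases contributes at most \<open>F zs\<close>. For the second largest this uses
  \<open>F \<ge> 0\<close> to drop the first term of \<open>new_second\<close>.\<close>

lemma average_G_le:
  "perm_average G T \<le>
     (perm_average F (T - {largest T}) + perm_average F (T - {second_largest T})) / card T"
proof -
  note lT = largest_second_largest[OF T(1,2)]
  have "perm_average G T = (\<Sum>x\<in>T. perm_average (\<lambda>zs. G (zs @ [x])) (T - {x})) / card T"
    using T by (intro perm_average_snoc) auto
  also have "\<dots> \<le> (\<Sum>x\<in>T. if x \<in> {largest T, second_largest T} then perm_average F (T - {x}) else 0) / card T"
  proof (intro divide_right_mono sum_mono)
    fix x assume x: "x \<in> T"
    have "perm_average (\<lambda>zs. G (zs @ [x])) (T - {x}) \<le>
      perm_average (\<lambda>zs. if x \<in> {largest T, second_largest T} then F zs else 0) (T - {x})"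
    proof (rule perm_average_mono)
      fix zs assume "zs \<in> permutations_of_set (T - {x})"
      note s = snoc_of_perm[OF x this]
      show "G (zs @ [x]) \<le> (if x \<in> {largest T, second_largest T} then F zs else 0)"
        using new_largest[OF s(1-3)] new_second[OF s(1-3)] F_nonneg[of "zs @ [x]"]
        unfolding G_def s(4) by auto
    qed
    also have "\<dots> = (if x \<in> {largest T, second_largest T} then perm_average F (T - {x}) else 0)"
      using T by (simp add: perm_average_const)
    finally show "perm_average (\<lambda>zs. G (zs @ [x])) (T - {x}) \<le> \<dots>" .
  qed simp
  also have "(\<Sum>x\<in>T. if x \<in> {largest T, second_largest T} then perm_average F (T - {x}) else 0) =
    (\<Sum>x\<in>{largest T, second_largest T}. perm_average F (T - {x}))"
    using T lT by (intro sum.mono_neutral_cong_right) auto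
  also have "\<dots> = perm_average F (T - {largest T}) + perm_average F (T - {second_largest T})"
    using lT by simp
  finally show ?thesis .
qed

text \<open>The part \<open>W - G\<close> is an inherited win: it vanishes if the last arrival is
  one of the top two and is at most \<open>W zs\<close> otherwise.\<close>

lemma average_W_le:
  "perm_average W T \<le> perm_average G T +
     (\<Sum>x\<in>T - {largest T, second_largest T}. perm_average W (T - {x})) / card T"
proof -
  note lT = largest_second_largest[OF T(1,2)]
  define W' where "W' ys = W ys - G ys" for ys
  have "perm_average W T = perm_average (\<lambda>ys. G ys + W' ys) T"
    by (simp add: W'_def)
  also have "\<dots> = perm_average G T + perm_average W' T"
    by (rule perm_average_add)
  also have "perm_average W' T = (\<Sum>x\<in>T. perm_average (\<lambda>zs. W' (zs @ [x])) (T - {x})) / card T"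
    using T by (intro perm_average_snoc) auto
  also have "\<dots> \<le> (\<Sum>x\<in>T. if x \<in> {largest T, second_largest T} then 0 else perm_average W (T - {x})) / card T"
  proof (intro divide_right_mono sum_mono)
    fix x assume x: "x \<in> T"
    have "perm_average (\<lambda>zs. W' (zs @ [x])) (T - {x}) \<le>
      perm_average (\<lambda>zs. if x \<in> {largest T, second_largest T} then 0 else W zs) (T - {x})"
    proof (rule perm_average_mono)
      fix zs assume "zs \<in> permutations_of_set (T - {x})"
      note s = snoc_of_perm[OF x this]
      show "W' (zs @ [x]) \<le> (if x \<in> {largest T, second_largest T} then 0 else W zs)"
        using new_other[OF s(1-3)] unfolding W'_def G_def s(4) by auto
    qed
    also have "\<dots> = (if x \<in> {largest T, second_largest T} then 0 else perm_average W (T - {x}))"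
      using T by (simp add: perm_average_const)
    finally show "perm_average (\<lambda>zs. W' (zs @ [x])) (T - {x}) \<le> \<dots>" .
  qed simp
  also have "(\<Sum>x\<in>T. if x \<in> {largest T, second_largest T} then 0 else perm_average W (T - {x})) =
    (\<Sum>x\<in>T - {largest T, second_largest T}. perm_average W (T - {x}))"
    using T lT by (intro sum.mono_neutral_cong_right) auto
  finally show ?thesis by simp
qed

end

end

section \<open>The linear program\<close>

text \<open>With \<open>s = 2 * m - t\<close> this is the sum of
  \<open>(t - 1) * (2 * m - t)\<close> over \<open>m < t \<le> 2 * m\<close>, that is,
  \<open>m - 1\<close> times the sum of \<open>g t / t\<close> above the threshold in the next
  lemma.\<close>

lemma sum_lessThan_linear:
  "(\<Sum>s<m. (2 * real m - 1 - real s) * real s) = (2 * real m - 1) * real m * (real m - 1) / 3"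
proof -
  have 1: "(\<Sum>s<m. real s) = real m * (real m - 1) / 2" for m
    by (induction m) (auto simp: field_simps)
  have 2: "(\<Sum>s<m. real s * real s) = real m * (real m - 1) * (2 * real m - 1) / 6" for m
    by (induction m) (auto simp: field_simps)
  have "(\<Sum>s<m. (2 * real m - 1 - real s) * real s) =
    (2 * real m - 1) * (\<Sum>s<m. real s) - (\<Sum>s<m. real s * real s)"
    by (simp add: sum_subtractf sum_distrib_left left_diff_distrib)
  thus ?thesis unfolding 1 2 by (simp add: field_simps)
qed

text \<open>Weak duality: the inequalities \<open>krec\<close> are weighted by multipliers
  \<open>g t\<close> and summed. With \<open>n = 2 * m\<close> the main terms are about
  \<open>5/3 * m^2\<close>, which is \<open>5/12 * n^2\<close>.\<close>

lemma threshold_potential_bound: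
  fixes k h :: "nat \<Rightarrow> real"
  assumes m: "m \<ge> 2" and "\<delta> \<ge> 0"
    and k0: "\<And>t. t \<le> 2 * m \<Longrightarrow> 0 \<le> k t" and h0: "\<And>t. t \<le> 2 * m \<Longrightarrow> 0 \<le> h t" and k1: "k 1 \<le> 1"
    and krec: "\<And>t. 2 \<le> t \<Longrightarrow> t \<le> 2 * m \<Longrightarrow> k t \<le> (1 + (real t - 1) * k (t - 1)) / t - h t + \<delta>"
    and hrec: "\<And>t. 2 \<le> t \<Longrightarrow> t \<le> 2 * m \<Longrightarrow> h t \<le> 2 * k (t - 1) / t + \<delta>"
  shows "(\<Sum>t=2..2*m. real t * (real t - 1) * h t)
           \<le> real m ^ 2 + real m * (2 * real m - 1) / 3 + (2 * real m) ^ 3 * \<delta>"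
proof -
  \<comment> \<open>\<open>g t / (n (n - 1))\<close> with \<open>n = 2 m\<close> is the marginal value of a free record holder after time
    \<open>t\<close>; it solves the dual linear program.\<close>
  define g where "g t = (if t \<le> m then real m * real t
    else real t * (real t - 1) * (2 * real m - real t) / (real m - 1))" for t
  \<comment> \<open>The loss of potential \<open>g t * k t\<close> pays for the gain, together with
    \<open>g t / t\<close>, the potential brought in by a new record holder, which appears with
    probability \<open>1 / t\<close>.\<close>
  have pot: "real t * (real t - 1) * h t + g t * k t \<le>
      g (t - 1) * k (t - 1) + g t / t + (2 * real m) ^ 2 * \<delta>"
    if t: "2 \<le> t" "t \<le> 2 * m" for t
  proof -
    define x where "x = real t"
    define K where "K = k (t - 1)"
    have x: "2 \<le> x" "x \<le> 2 * real m" using t by (auto simp: x_def)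
    have K: "0 \<le> K" using k0 t by (simp add: K_def)
    have H: "0 \<le> h t" using h0 t by simp
    have le1: "k t \<le> (1 + (x - 1) * K) / x - h t + \<delta>" using krec[OF t] by (simp add: x_def K_def)
    have le2: "h t \<le> 2 * K / x + \<delta>" using hrec[OF t] by (simp add: x_def K_def)
    show ?thesis
    proof (cases "t \<le> m")
      case True
      hence xm: "x \<le> real m" by (simp add: x_def)
      have "x * (x - 1) * h t + real m * x * k t \<le>
            x * (x - 1) * h t + real m * x * ((1 + (x - 1) * K) / x - h t + \<delta>)"
        using le1 x m by (intro add_left_mono mult_left_mono) auto
      also have "\<dots> = real m * (x - 1) * K + real m + (x * (x - 1 - real m)) * h t + real m * x * \<delta>"
        using x by (simp add: field_simps)
      \<comment> \<open>Up to \<open>m\<close>, matching the record holder costs more potential than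
        it gains, so the term with \<open>h t\<close> is dropped using only
        \<open>h t \<ge> 0\<close>.\<close>
      also have "(x * (x - 1 - real m)) * h t \<le> 0"
        using x xm H by (intro mult_nonpos_nonneg mult_nonneg_nonpos) auto
      also have "real m * x * \<delta> \<le> (2 * real m) ^ 2 * \<delta>"
        using x \<open>\<delta> \<ge> 0\<close> unfolding power2_eq_square by (intro mult_mono) auto
      finally have "x * (x - 1) * h t + real m * x * k t \<le>
        real m * (x - 1) * K + real m + (2 * real m) ^ 2 * \<delta>" by simp
      moreover have "t - 1 \<le> m" using True by simp
      ultimately show ?thesis using True t x by (simp add: g_def x_def K_def of_nat_diff)
    next
      case False
      hence xm: "real m + 1 \<le> x" by (simp add: x_def)
      define q where "q = (x - 1) * (2 * real m - x) / (real m - 1)"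
      have gt: "g t = x * q" using False by (simp add: g_def q_def x_def)
      have q0: "0 \<le> q" using x m by (simp add: q_def)
      have "(x - 1) * (2 * real m - x) \<le> (x - 1) * (real m - 1)"
        using x xm by (intro mult_left_mono) auto
      hence qle: "q \<le> x - 1" using m by (simp add: q_def field_simps)
      \<comment> \<open>For \<open>t = Suc m\<close> the index \<open>t - 1\<close> falls into the
        first branch of \<open>g\<close>; the formula still holds because both branches give
        \<open>m^2\<close> at \<open>m\<close>.\<close>
      have gt': "g (t - 1) = (x - 1) * (x - 2) * (2 * real m - x + 1) / (real m - 1)"
      proof (cases "t = Suc m")
        case True
        thus ?thesis using m by (simp add: g_def x_def field_simps)
      next
        case False
        hence "\<not> t - 1 \<le> m" using \<open>\<not> t \<le> m\<close> by simp
        thus ?thesis using t by (simp add: g_def x_def of_nat_diff algebra_simps)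
      qed
      \<comment> \<open>The left side is the coefficient of \<open>K\<close> once \<open>h t\<close>
        is replaced by \<open>2 * K / x\<close>. Equality with \<open>g (t - 1)\<close> is the tight
        dual constraint that determines \<open>g\<close> above the threshold.\<close>
      have bracket: "2 * (x - 1) + q * (x - 3) = g (t - 1)"
        unfolding gt' q_def using m by (simp add: field_simps)
      have "x * (x - 1) * h t + x * q * k t \<le>
            x * (x - 1) * h t + x * q * ((1 + (x - 1) * K) / x - h t + \<delta>)"
        using le1 x q0 by (intro add_left_mono mult_left_mono) auto
      also have "\<dots> = (x * (x - 1 - q)) * h t + q + q * (x - 1) * K + x * q * \<delta>"
        using x by (simp add: field_simps)
      \<comment> \<open>Past \<open>m\<close> the coefficient of \<open>h t\<close> is nonnegative
        by \<open>qle\<close>: accepting pays, so \<open>hrec\<close> is used in full.\<close>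
      also have "(x * (x - 1 - q)) * h t \<le> (x * (x - 1 - q)) * (2 * K / x + \<delta>)"
        using le2 x qle by (intro mult_left_mono) auto
      also have "(x * (x - 1 - q)) * (2 * K / x + \<delta>) + q + q * (x - 1) * K + x * q * \<delta>
        = (2 * (x - 1) + q * (x - 3)) * K + q + x * (x - 1) * \<delta>"
        using x by (simp add: field_simps)
      also have "x * (x - 1) * \<delta> \<le> (2 * real m) ^ 2 * \<delta>"
        using x \<open>\<delta> \<ge> 0\<close> unfolding power2_eq_square by (intro mult_right_mono mult_mono) auto
      finally have "x * (x - 1) * h t + x * q * k t \<le> g (t - 1) * K + q + (2 * real m) ^ 2 * \<delta>"
        unfolding bracket by simp
      thus ?thesis using x by (simp add: gt x_def[symmetric] K_def)
    qed
  qed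
  \<comment> \<open>The telescoped form of \<open>pot\<close>; the leading \<open>real m\<close> is
    the initial potential \<open>g 1\<close>, which bounds \<open>g 1 * k 1\<close>. At
    \<open>u = 2 * m\<close> the potential vanishes.\<close>
  have sum: "(\<Sum>t=2..u. real t * (real t - 1) * h t) + g u * k u \<le>
    real m + (\<Sum>t=2..u. g t / t) + u * ((2 * real m) ^ 2 * \<delta>)" if "1 \<le> u" "u \<le> 2 * m" for u
    using that
  proof (induction u rule: dec_induct)
    case base
    have "real m * k 1 \<le> real m * 1" using k1 by (intro mult_left_mono) auto
    thus ?case using m \<open>\<delta> \<ge> 0\<close> by (simp add: g_def add_increasing2)
  next
    case (step u)
    thus ?case using pot[of "Suc u"] by (simp add: algebra_simps)
  qed
  have "(\<Sum>t=2..2*m. g t / t) = (\<Sum>t=2..m. g t / t) + (\<Sum>t=m+1..2*m. g t / t)"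
    using m sum.ub_add_nat[of 2 m "\<lambda>t. g t / t" m] by (simp add: mult_2)
  also have "(\<Sum>t=2..m. g t / t) = (\<Sum>t=2..m. real m)"
    by (intro sum.cong) (auto simp: g_def)
  also have "(\<Sum>t=m+1..2*m. g t / t) =
      (\<Sum>t=m+1..2*m. (real t - 1) * (2 * real m - real t)) / (real m - 1)"
    unfolding sum_divide_distrib by (intro sum.cong) (auto simp: g_def)
  also have "(\<Sum>t=m+1..2*m. (real t - 1) * (2 * real m - real t)) =
      (\<Sum>s<m. (2 * real m - 1 - real s) * real s)"
    by (rule sum.reindex_bij_witness[of _ "\<lambda>s. 2 * m - s" "\<lambda>t. 2 * m - t"]) (auto simp: of_nat_diff)
  also have "\<dots> = (2 * real m - 1) * real m * (real m - 1) / 3"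
    by (rule sum_lessThan_linear)
  also have "(2 * real m - 1) * real m * (real m - 1) / 3 / (real m - 1) = real m * (2 * real m - 1) / 3"
  proof -
    have "a * b * d / 3 / d = b * a / 3" if "d \<noteq> 0" for a b d :: real using that by simp
    moreover have "real m - 1 \<noteq> 0" using m by auto
    ultimately show ?thesis by blast
  qed
  finally have "real m + (\<Sum>t=2..2*m. g t / t) = real m ^ 2 + real m * (2 * real m - 1) / 3"
    using m by (simp add: of_nat_diff power2_eq_square field_simps)
  moreover have "0 \<le> g (2 * m) * k (2 * m)" using k0 by (simp add: g_def)
  moreover have "real (2 * m) * ((2 * real m) ^ 2 * \<delta>) = (2 * real m) ^ 3 * \<delta>"
    by (simp add: power2_eq_square power3_eq_cube)
  moreover have "1 \<le> 2 * m" using m by simp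
  ultimately show ?thesis using sum[of "2 * m"] by linarith
qed

section \<open>From the game to the linear program\<close>

context top_two_game
begin

text \<open>Unrolls \<open>average_W_le\<close>. Up to normalization, \<open>t * (t - 1)\<close> is
  the probability that the final top two are both among the first \<open>t\<close> arrivals. In the
  induction, with \<open>card T = u + 1\<close>, the \<open>u - 1\<close> inherited terms
  \<open>u * perm_average W (T - {x})\<close> are each at most \<open>B / (u - 1)\<close>.\<close>

lemma average_W_sum_le:
  assumes "\<And>t T. 2 \<le> t \<Longrightarrow> t \<le> n \<Longrightarrow> T \<subseteq> S \<Longrightarrow> card T = t \<Longrightarrow> perm_average G T \<le> b t"
    and "finite S" "T \<subseteq> S" "1 \<le> card T" "card T \<le> n"
  shows "real (card T) * (real (card T) - 1) * perm_average W T \<le>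
         (\<Sum>t=2..card T. real t * (real t - 1) * b t)"
  using assms(3-5)
proof (induction "card T" arbitrary: T)
  case (Suc u)
  have fin: "finite T" using Suc.prems assms(2) finite_subset by blast
  show ?case
  proof (cases "u = 0")
    case True
    thus ?thesis by (simp flip: Suc.hyps(2))
  next
    case False
    hence T: "finite T" "card T \<ge> 2" "card T \<le> n" using fin Suc by auto
    note lT = largest_second_largest[OF T(1,2)]
    define B where "B = (\<Sum>t=2..u. real t * (real t - 1) * b t)"
    have IH: "real u * (real u - 1) * perm_average W (T - {x}) \<le> B" if "x \<in> T" for x
    proof -
      have c: "u = card (T - {x})" using that fin Suc.hyps(2) by simp
      have "T - {x} \<subseteq> S" "1 \<le> card (T - {x})" "card (T - {x}) \<le> n"
        using c False Suc.prems Suc.hyps(2) by auto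
      from Suc.hyps(1)[OF c this] show ?thesis unfolding B_def c .
    qed
    have card': "real (card (T - {largest T, second_largest T})) = real u - 1"
      using lT fin Suc.hyps(2) False by (subst card_Diff_subset) (auto simp: of_nat_diff)
    have "real (u + 1) * real u * perm_average W T \<le> real (u + 1) * real u *
        (perm_average G T + (\<Sum>x\<in>T - {largest T, second_largest T}. perm_average W (T - {x})) / (u + 1))"
      using average_W_le[OF T] Suc.hyps(2) by (intro mult_left_mono) auto
    also have "\<dots> = real (u + 1) * real u * perm_average G T +
        (\<Sum>x\<in>T - {largest T, second_largest T}. real u * perm_average W (T - {x}))"
      by (simp add: sum_distrib_left[symmetric] distrib_left)
    also have "perm_average G T \<le> b (u + 1)"
      using Suc T by (intro assms(1)) auto
    also have "(\<Sum>x\<in>T - {largest T, second_largest T}. real u * perm_average W (T - {x})) \<le> B"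
    \<comment> \<open>Here \<open>T\<close> consists of its top two only, so nothing is inherited;
      the division by \<open>u - 1\<close> below would fail.\<close>
    proof (cases "u = 1")
      case True
      hence none: "T - {largest T, second_largest T} = {}"
        using card' fin by (metis One_nat_def card_0_eq diff_self finite_Diff of_nat_0_eq_iff of_nat_1)
      show ?thesis unfolding none using True by (simp add: B_def)
    next
      case False
      have "(\<Sum>x\<in>T - {largest T, second_largest T}. real u * perm_average W (T - {x})) \<le>
            (\<Sum>x\<in>T - {largest T, second_largest T}. B / (real u - 1))"
        using IH False \<open>u \<noteq> 0\<close> by (intro sum_mono) (auto simp: field_simps)
      also have "\<dots> = B" using False \<open>u \<noteq> 0\<close> card' by simp
      finally show ?thesis .
    qed
    finally have "real (u + 1) * real u * perm_average W T \<le> real (u + 1) * real u * b (u + 1) + B"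
      by (simp add: mult_left_mono)
    thus ?thesis using False by (simp flip: Suc.hyps(2) add: B_def algebra_simps)
  qed
qed simp

text \<open>On \<open>S\<close> the averages of \<open>F\<close> and \<open>G\<close> depend, up to
  \<open>\<delta>\<close>, only on the size of the subset. Hence the set recursions above turn into
  recursions for the sequences \<open>k\<close> and \<open>h\<close>, to which
  \<open>threshold_potential_bound\<close> applies.\<close>

lemma average_W_le_on_homogeneous_set:
  assumes m: "m \<ge> 2" "n = 2 * m" and S: "finite S" "card S = n" and "\<delta> \<ge> 0"
    and k0: "\<And>t. t \<le> n \<Longrightarrow> 0 \<le> k t" and h0: "\<And>t. t \<le> n \<Longrightarrow> 0 \<le> h t"
    and k: "\<And>t T. t \<le> n \<Longrightarrow> T \<subseteq> S \<Longrightarrow> card T = t \<Longrightarrow>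
              k t \<le> perm_average F T \<and> perm_average F T \<le> k t + \<delta>"
    and h: "\<And>t T. t \<le> n \<Longrightarrow> T \<subseteq> S \<Longrightarrow> card T = t \<Longrightarrow>
              h t \<le> perm_average G T \<and> perm_average G T \<le> h t + \<delta>"
  shows "perm_average W S \<le> 5 / 12 + (1 / 4 + 2 * real n ^ 3 * \<delta>) / (real n - 1)"
proof -
  have ex: "\<exists>T\<subseteq>S. card T = t \<and> finite T" if "t \<le> n" for t
    using obtain_subset_with_card_n[of t S] that S by metis
  \<comment> \<open>Any \<open>T\<close> of size \<open>t\<close> serves as representative. Lower
    ends are used at \<open>T\<close> and upper ends at \<open>T - {x}\<close>, so the error is only
    \<open>(t - 1) / t * \<delta>\<close>; in \<open>hrec\<close> below it is
    \<open>2 / t * \<delta>\<close>, at most \<open>\<delta>\<close> since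
    \<open>t \<ge> 2\<close>.\<close>
  have krec: "k t \<le> (1 + (real t - 1) * k (t - 1)) / t - h t + \<delta>" if t: "2 \<le> t" "t \<le> 2 * m" for t
  proof -
    obtain T where T: "T \<subseteq> S" "card T = t" "finite T" using ex t m by auto
    have T': "finite T" "card T \<ge> 2" "card T \<le> n" using T t m by auto
    note lT = largest_second_largest[OF T'(1,2)]
    have le: "perm_average F (T - {x}) \<le> k (t - 1) + \<delta>" if "x \<in> T" for x
    proof -
      have "T - {x} \<subseteq> S" "card (T - {x}) = t - 1" "t - 1 \<le> n" using T t m that by auto
      with k show ?thesis by blast
    qed
    have "k t \<le> perm_average F T" using k[of t T] T t m by simp
    also have "\<dots> \<le> (1 + (\<Sum>x\<in>T - {largest T}. perm_average F (T - {x}))) / t - perm_average G T"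
      using average_F_le[OF T'] T by simp
    also have "(\<Sum>x\<in>T - {largest T}. perm_average F (T - {x})) \<le>
               (\<Sum>x\<in>T - {largest T}. k (t - 1) + \<delta>)"
      by (intro sum_mono le) auto
    also have "\<dots> = (real t - 1) * (k (t - 1) + \<delta>)"
      using T lT t by (simp add: of_nat_diff)
    also have "(1 + (real t - 1) * (k (t - 1) + \<delta>)) / t - perm_average G T \<le>
               (1 + (real t - 1) * (k (t - 1) + \<delta>)) / t - h t"
      using h[of t T] T t m by simp
    also have "\<dots> \<le> (1 + (real t - 1) * k (t - 1)) / t - h t + \<delta>"
      using t \<open>\<delta> \<ge> 0\<close> by (simp add: field_simps)
    finally show ?thesis by (simp add: divide_right_mono)
  qed
  have hrec: "h t \<le> 2 * k (t - 1) / t + \<delta>" if t: "2 \<le> t" "t \<le> 2 * m" for t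
  proof -
    obtain T where T: "T \<subseteq> S" "card T = t" "finite T" using ex t m by auto
    have T': "finite T" "card T \<ge> 2" "card T \<le> n" using T t m by auto
    note lT = largest_second_largest[OF T'(1,2)]
    have le: "perm_average F (T - {x}) \<le> k (t - 1) + \<delta>" if "x \<in> T" for x
    proof -
      have "T - {x} \<subseteq> S" "card (T - {x}) = t - 1" "t - 1 \<le> n" using T t m that by auto
      with k show ?thesis by blast
    qed
    have "h t \<le> perm_average G T" using h[of t T] T t m by simp
    also have "\<dots> \<le> (perm_average F (T - {largest T}) + perm_average F (T - {second_largest T})) / t"
      using average_G_le[OF T'] T by simp
    also have "\<dots> \<le> ((k (t - 1) + \<delta>) + (k (t - 1) + \<delta>)) / t"
      using lT by (intro divide_right_mono add_mono le) auto
    also have "\<dots> = 2 * k (t - 1) / t + (2 / t) * \<delta>"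
      by (simp add: add_divide_distrib)
    also have "(2 / t) * \<delta> \<le> 1 * \<delta>"
      using t \<open>\<delta> \<ge> 0\<close> by (intro mult_right_mono) auto
    finally show ?thesis by simp
  qed
  have k1: "k 1 \<le> 1"
  proof -
    obtain T where T: "T \<subseteq> S" "card T = 1" "finite T" using ex[of 1] m by auto
    have "k 1 \<le> perm_average F T" using k[of 1 T] T m by simp
    also have "\<dots> \<le> perm_average (\<lambda>_. 1) T" using F_le_1 by (intro perm_average_mono)
    finally show ?thesis using T by (simp add: perm_average_const)
  qed
  have "real n * (real n - 1) * perm_average W S \<le> (\<Sum>t=2..n. real t * (real t - 1) * (h t + \<delta>))"
    using average_W_sum_le[of S "\<lambda>t. h t + \<delta>" S] S h m by auto
  also have "\<dots> = (\<Sum>t=2..2*m. real t * (real t - 1) * h t) + (\<Sum>t=2..n. real t * (real t - 1) * \<delta>)"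
    by (simp add: distrib_left sum.distrib m)
  also have "(\<Sum>t=2..2*m. real t * (real t - 1) * h t) \<le>
      real m ^ 2 + real m * (2 * real m - 1) / 3 + (2 * real m) ^ 3 * \<delta>"
    using m k0 h0 k1 krec hrec \<open>\<delta> \<ge> 0\<close> by (intro threshold_potential_bound[of m \<delta> k h]) auto
  also have "(\<Sum>t=2..n. real t * (real t - 1) * \<delta>) \<le> (\<Sum>t\<in>{2..n}. real n * real n * \<delta>)"
    using \<open>\<delta> \<ge> 0\<close> by (intro sum_mono mult_right_mono mult_mono) auto
  also have "\<dots> \<le> real n * (real n * real n * \<delta>)"
    using \<open>\<delta> \<ge> 0\<close> by (auto intro!: mult_right_mono)
  finally have "real n * (real n - 1) * perm_average W S \<le>
      real m ^ 2 + real m * (2 * real m - 1) / 3 + 2 * real n ^ 3 * \<delta>"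
    by (simp add: m power3_eq_cube algebra_simps)
  \<comment> \<open>The crude factor \<open>real n\<close> on the error lets it share the
    denominator \<open>real n - 1\<close> with the lower-order term; the main terms then match
    exactly, leaving the constant \<open>1 / 4\<close>.\<close>
  also have "\<dots> \<le> real m ^ 2 + real m * (2 * real m - 1) / 3 + real n * (2 * real n ^ 3 * \<delta>)"
  proof -
    have "1 * (2 * real n ^ 3 * \<delta>) \<le> real n * (2 * real n ^ 3 * \<delta>)"
      using \<open>\<delta> \<ge> 0\<close> m by (intro mult_right_mono) auto
    thus ?thesis by simp
  qed
  also have "\<dots> = real n * (real n - 1) * (5 / 12 + (1 / 4 + 2 * real n ^ 3 * \<delta>) / (real n - 1))"
  proof -
    have "N * d * (c + e / d) = N * d * c + N * e" if "d \<noteq> 0" for N d c e :: real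
      using that by (simp add: distrib_left)
    moreover have "real n - 1 \<noteq> 0" using m by auto
    ultimately have eq: "real n * (real n - 1) * (5 / 12 + (1 / 4 + 2 * real n ^ 3 * \<delta>) / (real n - 1)) =
      real n * (real n - 1) * (5 / 12) + real n * (1 / 4 + 2 * real n ^ 3 * \<delta>)"
      by blast
    show ?thesis unfolding eq unfolding m by (simp add: power2_eq_square field_simps)
  qed
  finally show ?thesis using m by (simp add: mult_le_cancel_left_pos)
qed

end

section \<open>Runs of an online algorithm on values with a dominant top pair\<close>

text \<open>The \<open>i\<close>-th arrival is vertex \<open>vs ! i\<close> with value
  \<open>ys ! i\<close>. Vertex names and values are kept apart so that each can be averaged over
  separately, and \<open>ys\<close> may be shorter than \<open>vs\<close>, so that runs on prefixes
  do not mention later values.\<close>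

definition arrival_weight :: "real \<Rightarrow> nat list \<Rightarrow> nat list \<Rightarrow> nat set \<Rightarrow> real" where
  "arrival_weight C vs ys e = C ^ (\<Sum>i | i < length ys \<and> vs ! i \<in> e. ys ! i)"

abbreviation matching_after :: "decision_rule \<Rightarrow> real \<Rightarrow> nat list \<Rightarrow> nat list \<Rightarrow> nat set set" where
  "matching_after D C vs ys \<equiv> online_matching D (arrival_weight C vs ys) vs (length ys)"

definition top_free :: "decision_rule \<Rightarrow> real \<Rightarrow> nat list \<Rightarrow> nat list \<Rightarrow> bool" where
  "top_free D C vs ys \<longleftrightarrow>
     (\<exists>i<length ys. ys ! i = largest (set ys) \<and> vs ! i \<notin> \<Union>(matching_after D C vs ys))"

definition top_two_matched :: "decision_rule \<Rightarrow> real \<Rightarrow> nat list \<Rightarrow> nat list \<Rightarrow> bool" where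
  "top_two_matched D C vs ys \<longleftrightarrow>
     (\<exists>i<length ys. \<exists>j<length ys. ys ! i = largest (set ys) \<and> ys ! j = second_largest (set ys) \<and>
        {vs ! i, vs ! j} \<in> matching_after D C vs ys)"

lemma top_free_iff:
  assumes "distinct ys" "i < length ys" "ys ! i = largest (set ys)"
  shows "top_free D C vs ys \<longleftrightarrow> vs ! i \<notin> \<Union>(matching_after D C vs ys)"
  using assms unfolding top_free_def by (metis nth_eq_iff_index_eq)

lemma top_two_matched_iff:
  assumes "distinct ys" "i < length ys" "ys ! i = largest (set ys)"
    "j < length ys" "ys ! j = second_largest (set ys)"
  shows "top_two_matched D C vs ys \<longleftrightarrow> {vs ! i, vs ! j} \<in> matching_after D C vs ys"
  using assms unfolding top_two_matched_def by (metis nth_eq_iff_index_eq)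

text \<open>The online property: decisions up to time \<open>t\<close> see only weights between the
  first \<open>t\<close> arrivals.\<close>

lemma online_matching_cong:
  assumes "\<And>e. e \<subseteq> set (take t vs) \<Longrightarrow> card e = 2 \<Longrightarrow> w e = w' e"
  shows "online_matching D w vs t = online_matching D w' vs t"
  using assms
proof (induction t)
  case (Suc t)
  have "set (take t vs) \<subseteq> set (take (Suc t) vs)" by (rule set_take_subset_set_take) simp
  hence "online_matching D w vs t = online_matching D w' vs t"
    using Suc.prems by (intro Suc.IH) auto
  moreover have "revealed w (take (Suc t) vs) = revealed w' (take (Suc t) vs)"
    unfolding revealed_def using Suc.prems by (intro restrict_ext) auto
  ultimately show ?case by simp
qed simp

lemma online_matching_Suc_cases:
  obtains "online_matching D w vs (Suc t) = online_matching D w vs t"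
  | u where "u \<in> set (take t vs)" "u \<notin> \<Union>(online_matching D w vs t)"
      "online_matching D w vs (Suc t) = insert {u, vs ! t} (online_matching D w vs t)"
proof (cases "D (take (Suc t) vs) (revealed w (take (Suc t) vs))")
  case None
  thus ?thesis using that(1) by simp
next
  case (Some u)
  hence eq: "online_matching D w vs (Suc t) =
    (if u \<in> set (take t vs) - \<Union>(online_matching D w vs t)
     then insert {u, vs ! t} (online_matching D w vs t) else online_matching D w vs t)"
    by (simp only: online_matching.simps Let_def option.case)
  show ?thesis
  proof (cases "u \<in> set (take t vs) - \<Union>(online_matching D w vs t)")
    case True
    from eq[unfolded if_P[OF True]] True show ?thesis
      by (intro that(2)[of u]) simp_all
  next
    case False
    from eq[unfolded if_not_P[OF False]] show ?thesis by (rule that(1))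
  qed
qed

lemma nth_notin_set_take:
  assumes "distinct vs" "t < length vs"
  shows "vs ! t \<notin> set (take t vs)"
  using assms by (auto simp: in_set_conv_nth nth_eq_iff_index_eq)

lemma online_matching_edge:
  assumes "distinct vs" "t \<le> length vs" "e \<in> online_matching D w vs t"
  shows "e \<subseteq> set (take t vs) \<and> card e = 2"
  using assms(2,3)
proof (induction t)
  case (Suc t)
  have sub: "set (take t vs) \<subseteq> set (take (Suc t) vs)" by (rule set_take_subset_set_take) simp
  have new: "vs ! t \<in> set (take (Suc t) vs)" "vs ! t \<notin> set (take t vs)"
    using Suc.prems nth_notin_set_take[OF assms(1), of t] by (auto simp: take_Suc_conv_app_nth)
  from online_matching_Suc_cases[of D w vs t] show ?case
  proof cases
    case 1
    thus ?thesis using Suc sub by auto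
  next
    case (2 u)
    hence "u \<noteq> vs ! t" using new by auto
    with 2 Suc sub new show ?thesis by auto
  qed
qed simp

lemma finite_online_matching: "finite (online_matching D w vs t) \<and> card (online_matching D w vs t) \<le> t"
proof (induction t)
  case (Suc t)
  from online_matching_Suc_cases[of D w vs t] show ?case
  proof cases
    case 1
    thus ?thesis using Suc by (auto simp del: online_matching.simps)
  next
    case (2 u)
    thus ?thesis using Suc card_insert_le_m1[of "Suc t" "online_matching D w vs t" "{u, vs ! t}"]
      by (auto simp del: online_matching.simps)
  qed
qed simp

lemma obtain_nth:
  assumes "x \<in> set xs"
  obtains i where "i < length xs" "xs ! i = x"
  using assms by (auto simp: in_set_conv_nth)

section \<open>Effect of a single arrival on the top two values\<close>

context
  fixes D :: decision_rule and C :: real and vs zs :: "nat list" and x :: nat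
  assumes vs: "distinct vs" "length zs < length vs"
    and dist: "distinct (zs @ [x])" and ne: "zs \<noteq> []"
begin

text \<open>Appending a value changes no weight between earlier vertices, so the run on
  \<open>zs @ [x]\<close> extends the run on \<open>zs\<close> by one step.\<close>

lemma matching_after_snoc_cases:
  obtains "matching_after D C vs (zs @ [x]) = matching_after D C vs zs"
  | u where "u \<notin> \<Union>(matching_after D C vs zs)"
      "matching_after D C vs (zs @ [x]) = insert {u, vs ! length zs} (matching_after D C vs zs)"
proof -
  have "online_matching D (arrival_weight C vs (zs @ [x])) vs (length zs) = matching_after D C vs zs"
  proof (rule online_matching_cong)
    fix e assume "e \<subseteq> set (take (length zs) vs)"
    hence "vs ! length zs \<notin> e" using nth_notin_set_take[OF vs] by auto
    hence "{i. i < length (zs @ [x]) \<and> vs ! i \<in> e} = {i. i < length zs \<and> vs ! i \<in> e}"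
      by (auto simp: less_Suc_eq)
    thus "arrival_weight C vs (zs @ [x]) e = arrival_weight C vs zs e"
      unfolding arrival_weight_def by (auto intro!: arg_cong[where f="\<lambda>k. C ^ k"] sum.cong simp: nth_append)
  qed
  thus ?thesis
    using online_matching_Suc_cases[of D "arrival_weight C vs (zs @ [x])" vs "length zs"] that
    by (metis length_append_singleton)
qed

lemma last_notin_matching_after: "vs ! length zs \<notin> \<Union>(matching_after D C vs zs)"
  using online_matching_edge[OF vs(1), of "length zs"] nth_notin_set_take[OF vs] vs by fastforce

lemma matching_after_subset_snoc: "matching_after D C vs zs \<subseteq> matching_after D C vs (zs @ [x])"
  by (rule matching_after_snoc_cases) auto

text \<open>An edge at the newcomer can only have been added in this step, and only to a free
  partner.\<close>

lemma new_edge_snoc: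
  assumes "{vs ! length zs, v} \<in> matching_after D C vs (zs @ [x])" "v \<noteq> vs ! length zs"
  shows "v \<notin> \<Union>(matching_after D C vs zs)"
proof -
  have old: "{vs ! length zs, v} \<notin> matching_after D C vs zs"
    using last_notin_matching_after by (meson UnionI insertI1)
  show ?thesis
  proof (rule matching_after_snoc_cases)
    assume "matching_after D C vs (zs @ [x]) = matching_after D C vs zs"
    with assms(1) old show ?thesis by simp
  next
    fix u assume u: "u \<notin> \<Union>(matching_after D C vs zs)"
      "matching_after D C vs (zs @ [x]) = insert {u, vs ! length zs} (matching_after D C vs zs)"
    have "{vs ! length zs, v} = {u, vs ! length zs}"
      using assms(1) old unfolding u(2) by simp
    with assms(2) have "u = v" by (auto simp: doubleton_eq_iff)
    with u(1) show ?thesis by blast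
  qed
qed

lemma old_edge_snoc:
  assumes "{vs ! i, vs ! j} \<in> matching_after D C vs (zs @ [x])" "i < length zs" "j < length zs"
  shows "{vs ! i, vs ! j} \<in> matching_after D C vs zs"
proof (rule matching_after_snoc_cases)
  fix u assume u: "matching_after D C vs (zs @ [x]) = insert {u, vs ! length zs} (matching_after D C vs zs)"
  have "vs ! i \<noteq> vs ! length zs" "vs ! j \<noteq> vs ! length zs"
    using vs assms by (auto simp: nth_eq_iff_index_eq)
  with u assms(1) show ?thesis by (auto simp: doubleton_eq_iff)
qed (use assms in simp)

lemma card_snoc: "finite (set (zs @ [x]))" "card (set (zs @ [x])) \<ge> 2"
  using dist ne distinct_card[OF dist] by (auto simp: Suc_le_eq)

lemmas largest_snoc = largest_second_largest[OF card_snoc]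

lemma largest_zs: "x \<noteq> largest (set (zs @ [x])) \<Longrightarrow> largest (set zs) = largest (set (zs @ [x]))"
  using largest_snoc(1) largest_snoc(4) unfolding largest_def[of "set zs"]
  by (intro Max_eqI) auto

text \<open>The previous record holder becomes the second largest, so the top edge joins it to the
  newcomer and uses up the newcomer, who is the new record holder.\<close>

lemma top_two_snoc_largest:
  assumes x: "x = largest (set (zs @ [x]))"
  shows "top_two_matched D C vs (zs @ [x]) \<Longrightarrow> top_free D C vs zs"
    and "\<not> (top_two_matched D C vs (zs @ [x]) \<and> top_free D C vs (zs @ [x]))"
proof -
  have sec: "second_largest (set (zs @ [x])) = largest (set zs)"
  proof -
    have "set (zs @ [x]) - {x} = set zs" using dist by auto
    thus ?thesis using x unfolding second_largest_def largest_def by metis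
  qed
  have "largest (set zs) \<in> set zs" using ne by (simp add: largest_def)
  then obtain a where a: "a < length zs" "zs ! a = largest (set zs)" by (rule obtain_nth)
  have free: "top_free D C vs zs \<longleftrightarrow> vs ! a \<notin> \<Union>(matching_after D C vs zs)"
    using dist a by (intro top_free_iff) auto
  have free': "top_free D C vs (zs @ [x]) \<longleftrightarrow> vs ! length zs \<notin> \<Union>(matching_after D C vs (zs @ [x]))"
    using dist x by (intro top_free_iff) auto
  have won: "top_two_matched D C vs (zs @ [x]) \<longleftrightarrow> {vs ! length zs, vs ! a} \<in> matching_after D C vs (zs @ [x])"
    using dist x a sec by (intro top_two_matched_iff) (auto simp: nth_append)
  have "vs ! a \<noteq> vs ! length zs" using vs a by (auto simp: nth_eq_iff_index_eq)
  thus "top_two_matched D C vs (zs @ [x]) \<Longrightarrow> top_free D C vs zs"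
    unfolding free won by (rule new_edge_snoc[rotated])
  show "\<not> (top_two_matched D C vs (zs @ [x]) \<and> top_free D C vs (zs @ [x]))"
    unfolding free' won by blast
qed

lemma top_free_snoc:
  assumes x: "x \<noteq> largest (set (zs @ [x]))"
  shows "top_free D C vs (zs @ [x]) \<Longrightarrow> top_free D C vs zs"
proof -
  have "largest (set zs) \<in> set zs" using ne by (simp add: largest_def)
  then obtain a where a: "a < length zs" "zs ! a = largest (set zs)" by (rule obtain_nth)
  have free: "top_free D C vs zs \<longleftrightarrow> vs ! a \<notin> \<Union>(matching_after D C vs zs)"
    using dist a by (intro top_free_iff) auto
  have free': "top_free D C vs (zs @ [x]) \<longleftrightarrow> vs ! a \<notin> \<Union>(matching_after D C vs (zs @ [x]))"
    using dist a largest_zs[OF x] by (intro top_free_iff) (auto simp: nth_append)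
  show "top_free D C vs (zs @ [x]) \<Longrightarrow> top_free D C vs zs"
    unfolding free free' using matching_after_subset_snoc by blast
qed

text \<open>The record holder stays and the top edge joins it to the newcomer; taking that edge
  needs it free before and leaves it matched afterwards.\<close>

lemma top_two_snoc_second:
  assumes x: "x = second_largest (set (zs @ [x]))"
  shows "top_two_matched D C vs (zs @ [x]) \<Longrightarrow> top_free D C vs zs"
    and "\<not> (top_two_matched D C vs (zs @ [x]) \<and> top_free D C vs (zs @ [x]))"
proof -
  have x': "x \<noteq> largest (set (zs @ [x]))" using largest_snoc(3) x by auto
  have "largest (set zs) \<in> set zs" using ne by (simp add: largest_def)
  then obtain a where a: "a < length zs" "zs ! a = largest (set zs)" by (rule obtain_nth)
  have free: "top_free D C vs zs \<longleftrightarrow> vs ! a \<notin> \<Union>(matching_after D C vs zs)"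
    using dist a by (intro top_free_iff) auto
  have free': "top_free D C vs (zs @ [x]) \<longleftrightarrow> vs ! a \<notin> \<Union>(matching_after D C vs (zs @ [x]))"
    using dist a largest_zs[OF x'] by (intro top_free_iff) (auto simp: nth_append)
  have "top_two_matched D C vs (zs @ [x]) \<longleftrightarrow> {vs ! a, vs ! length zs} \<in> matching_after D C vs (zs @ [x])"
    using dist x a largest_zs[OF x'] by (intro top_two_matched_iff) (auto simp: nth_append)
  hence won: "top_two_matched D C vs (zs @ [x]) \<longleftrightarrow> {vs ! length zs, vs ! a} \<in> matching_after D C vs (zs @ [x])"
    by (simp add: insert_commute)
  have "vs ! a \<noteq> vs ! length zs" using vs a by (auto simp: nth_eq_iff_index_eq)
  thus "top_two_matched D C vs (zs @ [x]) \<Longrightarrow> top_free D C vs zs"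
    unfolding free won by (rule new_edge_snoc[rotated])
  show "\<not> (top_two_matched D C vs (zs @ [x]) \<and> top_free D C vs (zs @ [x]))"
    unfolding free' won by blast
qed

text \<open>The top two stay the same, and an edge between two earlier vertices cannot be created by
  a later arrival.\<close>

lemma top_two_snoc_other:
  assumes x: "x \<noteq> largest (set (zs @ [x]))" "x \<noteq> second_largest (set (zs @ [x]))"
  shows "top_two_matched D C vs (zs @ [x]) \<Longrightarrow> top_two_matched D C vs zs"
proof -
  have "largest (set zs) \<in> set zs" using ne by (simp add: largest_def)
  then obtain a where a: "a < length zs" "zs ! a = largest (set zs)" by (rule obtain_nth)
  have "second_largest (set (zs @ [x])) \<in> set zs" using largest_snoc(2) x by auto
  then obtain b where b: "b < length zs" "zs ! b = second_largest (set (zs @ [x]))" by (rule obtain_nth)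
  have mem: "second_largest (set (zs @ [x])) \<in> set zs - {largest (set zs)}"
    using largest_snoc(2,3) x largest_zs[OF x(1)] by auto
  have "Max (set zs - {largest (set zs)}) = second_largest (set (zs @ [x]))"
    using mem largest_snoc(5) largest_zs[OF x(1)] by (intro Max_eqI) auto
  hence "second_largest (set zs) = second_largest (set (zs @ [x]))"
    by (simp only: second_largest_def[of "set zs"] largest_def[of "set zs"])
  hence won: "top_two_matched D C vs zs \<longleftrightarrow> {vs ! a, vs ! b} \<in> matching_after D C vs zs"
    using dist a b by (intro top_two_matched_iff) auto
  have won': "top_two_matched D C vs (zs @ [x]) \<longleftrightarrow> {vs ! a, vs ! b} \<in> matching_after D C vs (zs @ [x])"
    using dist a b largest_zs[OF x(1)] by (intro top_two_matched_iff) (auto simp: nth_append)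
  show "top_two_matched D C vs (zs @ [x]) \<Longrightarrow> top_two_matched D C vs zs"
    unfolding won won' using old_edge_snoc a b by blast
qed

end

section \<open>Weights of matchings and relabelling of vertices\<close>

lemma arrival_weight_pair:
  assumes "distinct vs" "length ys \<le> length vs" "i < length ys" "j < length ys" "i \<noteq> j"
  shows "arrival_weight C vs ys {vs ! i, vs ! j} = C ^ (ys ! i + ys ! j)"
proof -
  have "{l. l < length ys \<and> vs ! l \<in> {vs ! i, vs ! j}} = {i, j}"
    using assms by (auto simp: nth_eq_iff_index_eq)
  thus ?thesis using assms(5) by (simp add: arrival_weight_def)
qed

text \<open>Values are integers, so any edge other than the top one has an exponent smaller by at
  least 1 and loses a factor \<open>C\<close>; a matching has at most \<open>n\<close>
  edges.\<close>

lemma sum_arrival_weight_le: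
  assumes vs: "distinct vs" "length vs = n" and ys: "ys \<in> permutations_of_set S"
    and S: "finite S" "card S = n" "n \<ge> 2" and C: "C \<ge> 1"
  shows "sum (arrival_weight C vs ys) (online_matching D (arrival_weight C vs ys) vs n) \<le>
     C ^ (largest S + second_largest S) * (of_bool (top_two_matched D C vs ys) + n / C)"
proof -
  define M where "M = online_matching D (arrival_weight C vs ys) vs n"
  define s where "s = largest S + second_largest S"
  have ys': "set ys = S" "distinct ys" using ys by (auto simp: permutations_of_set_def)
  hence len: "length ys = n" using S distinct_card by metis
  have "finite S" "card S \<ge> 2" using S by auto
  note lS = largest_second_largest[OF this]
  obtain a where a: "a < length ys" "ys ! a = largest S" using lS(1) ys' by (metis in_set_conv_nth)
  obtain b where b: "b < length ys" "ys ! b = second_largest S" using lS(2) ys' by (metis in_set_conv_nth)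
  define top where "top = {vs ! a, vs ! b}"
  have won: "top_two_matched D C vs ys \<longleftrightarrow> top \<in> M"
    unfolding top_def M_def using ys' a b len by (subst top_two_matched_iff[of ys a b]) auto
  have M: "finite M" "card M \<le> n" unfolding M_def using finite_online_matching by auto
  have le: "arrival_weight C vs ys e \<le> C ^ s * (of_bool (e = top) + 1 / C)" if e: "e \<in> M" for e
  proof -
    have "e \<subseteq> set vs" "card e = 2"
      using online_matching_edge[OF vs(1) _ e[unfolded M_def]] vs by auto
    then obtain u v where uv: "e = {u, v}" "u \<noteq> v" "u \<in> set vs" "v \<in> set vs"
      by (auto simp: card_2_iff)
    then obtain i j where ij: "u = vs ! i" "v = vs ! j" "i < n" "j < n" "i \<noteq> j"
      using vs by (metis in_set_conv_nth)
    have w: "arrival_weight C vs ys e = C ^ (ys ! i + ys ! j)"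
      unfolding uv ij using vs ij len by (intro arrival_weight_pair) auto
    show ?thesis
    proof (cases "e = top")
      case True
      hence "arrival_weight C vs ys e = C ^ (ys ! a + ys ! b)"
        unfolding True top_def using vs a b len lS(3) by (intro arrival_weight_pair) auto
      also have "\<dots> \<le> C ^ s * (1 + 1 / C)" using C by (simp add: s_def a b distrib_left)
      finally show ?thesis using True by simp
    next
      case False
      have mem: "ys ! i \<in> S" "ys ! j \<in> S" using ys' ij len by auto
      have ne: "ys ! i \<noteq> ys ! j" using ys' ij len by (simp add: nth_eq_iff_index_eq)
      \<comment> \<open>The values are distinct, so only the top pair itself reaches the sum
        \<open>s\<close>.\<close>
      have "ys ! i + ys ! j < s"
      proof (rule ccontr)
        assume ge: "\<not> ys ! i + ys ! j < s"
        have "(ys ! i = largest S \<and> ys ! j = second_largest S) \<or> (ys ! j = largest S \<and> ys ! i = second_largest S)"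
          using ge mem ne lS(3) lS(4)[OF mem(1)] lS(4)[OF mem(2)] lS(5)[OF mem(1)] lS(5)[OF mem(2)]
          unfolding s_def by linarith
        hence "(i = a \<and> j = b) \<or> (j = a \<and> i = b)"
          using a b ij len ys'(2) by (metis nth_eq_iff_index_eq)
        thus False using False unfolding uv(1) ij(1,2) top_def by auto
      qed
      hence "C ^ Suc (ys ! i + ys ! j) \<le> C ^ s"
        using C by (intro power_increasing) auto
      thus ?thesis using False C by (simp add: w pos_le_divide_eq mult.commute)
    qed
  qed
  have "sum (arrival_weight C vs ys) M \<le> (\<Sum>e\<in>M. C ^ s * (of_bool (e = top) + 1 / C))"
    by (intro sum_mono le)
  also have "\<dots> = C ^ s * (of_bool (top \<in> M) + card M / C)"
    using M by (simp add: sum_distrib_left[symmetric] sum.distrib of_bool_def)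
  also have "\<dots> \<le> C ^ s * (of_bool (top \<in> M) + n / C)"
    using C M by (intro mult_left_mono add_left_mono divide_right_mono) auto
  finally show ?thesis unfolding M_def s_def won .
qed

text \<open>
  An instance labels vertex \<open>i\<close> with the value \<open>ys ! i\<close>; the values then arrive in the order
  \<open>map ((!) ys) vs\<close>.
\<close>

lemma arrival_weight_relabel:
  assumes "vs \<in> permutations_of_set {..<n}" "length ys = n"
  shows "arrival_weight C [0..<n] ys = arrival_weight C vs (map ((!) ys) vs)"
proof
  fix e
  have vs: "set vs = {..<n}" "distinct vs" using assms by (auto simp: permutations_of_set_def)
  hence len: "length vs = n" using distinct_card[of vs] by simp
  have "(\<Sum>i | i < length ys \<and> [0..<n] ! i \<in> e. ys ! i) = (\<Sum>i\<in>{..<n} \<inter> e. ys ! i)"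
    using assms by (intro sum.cong) auto
  also have "\<dots> = (\<Sum>i | i < n \<and> vs ! i \<in> e. map ((!) ys) vs ! i)"
  proof (rule sum.reindex_bij_betw[of "(!) vs", symmetric, THEN trans])
    show "bij_betw ((!) vs) {i. i < n \<and> vs ! i \<in> e} ({..<n} \<inter> e)"
    proof (rule bij_betw_imageI)
      show "inj_on ((!) vs) {i. i < n \<and> vs ! i \<in> e}"
        using vs len by (auto simp: inj_on_def nth_eq_iff_index_eq)
      show "(!) vs ` {i. i < n \<and> vs ! i \<in> e} = {..<n} \<inter> e"
        unfolding vs(1)[symmetric] using len by (auto simp: set_conv_nth)
    qed
    show "(\<Sum>x | x < n \<and> vs ! x \<in> e. ys ! (vs ! x)) = (\<Sum>i | i < n \<and> vs ! i \<in> e. map ((!) ys) vs ! i)"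
      using len by (intro sum.cong) auto
  qed
  finally show "arrival_weight C [0..<n] ys e = arrival_weight C vs (map ((!) ys) vs) e"
    using len by (simp add: arrival_weight_def)
qed

text \<open>Rearranging positions by a fixed \<open>vs\<close> is an injective self-map of a finite
  set, hence bijective. Thus under a random labelling the values arrive in uniformly random order
  whatever the vertex order is.\<close>

lemma sum_permutations_relabel:
  assumes vs: "vs \<in> permutations_of_set {..<card S}"
  shows "(\<Sum>ys\<in>permutations_of_set S. f (map ((!) ys) vs)) = (\<Sum>ys\<in>permutations_of_set S. f ys)"
proof -
  have vs': "set vs = {..<card S}" "distinct vs" using vs by (auto simp: permutations_of_set_def)
  have ys: "set ys = S" "distinct ys" "length ys = card S" if "ys \<in> permutations_of_set S" for ys
    using that distinct_card[of ys] by (auto simp: permutations_of_set_def)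
  let ?g = "\<lambda>ys. map ((!) ys) vs"
  have inj: "inj_on ?g (permutations_of_set S)"
  proof (rule inj_onI)
    fix ys ys' assume "ys \<in> permutations_of_set S" "ys' \<in> permutations_of_set S" "?g ys = ?g ys'"
    thus "ys = ys'" using ys vs' by (intro nth_equalityI) auto
  qed
  have "?g ` permutations_of_set S \<subseteq> permutations_of_set S"
  proof
    fix zs assume "zs \<in> ?g ` permutations_of_set S"
    then obtain p where p: "p \<in> permutations_of_set S" "zs = ?g p" by auto
    have "set zs = (!) p ` {..<length p}" using ys[OF p(1)] vs' by (simp add: p(2))
    also have "\<dots> = set p" by (auto simp: set_conv_nth)
    finally have "set zs = S" using ys[OF p(1)] by simp
    moreover have "distinct zs"
      using ys[OF p(1)] vs' by (auto simp: p(2) distinct_map inj_on_def nth_eq_iff_index_eq)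
    ultimately show "zs \<in> permutations_of_set S" by (rule permutations_of_setI)
  qed
  hence "?g ` permutations_of_set S = permutations_of_set S"
    using inj by (intro endo_inj_surj) auto
  thus ?thesis using sum.reindex[OF inj, of f] by (simp add: comp_def)
qed

lemma power_le_max_matching_weight:
  assumes ys: "ys \<in> permutations_of_set S" and S: "finite S" "card S = n" "n \<ge> 2"
  shows "C ^ (largest S + second_largest S) \<le> max_matching_weight n (arrival_weight C [0..<n] ys)"
proof -
  have ys': "set ys = S" "distinct ys" using ys by (auto simp: permutations_of_set_def)
  hence len: "length ys = n" using S distinct_card by metis
  have "finite S" "card S \<ge> 2" using S by auto
  note lS = largest_second_largest[OF this]
  obtain a where a: "a < length ys" "ys ! a = largest S" using lS(1) ys' by (metis in_set_conv_nth)
  obtain b where b: "b < length ys" "ys ! b = second_largest S" using lS(2) ys' by (metis in_set_conv_nth)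
  have "a \<noteq> b" using a b lS(3) by auto
  hence w: "arrival_weight C [0..<n] ys {a, b} = C ^ (largest S + second_largest S)"
    using arrival_weight_pair[of "[0..<n]" ys a b C] a b len by simp
  have "is_matching n {{a, b}}"
    using a b len \<open>a \<noteq> b\<close> by (auto simp: is_matching_def complete_edges_def)
  moreover have "finite {M. is_matching n M}"
    by (rule finite_subset[of _ "Pow (Pow {..<n})"]) (auto simp: is_matching_def complete_edges_def)
  hence "finite {sum (arrival_weight C [0..<n] ys) M | M. is_matching n M}" by simp
  ultimately have "sum (arrival_weight C [0..<n] ys) {{a, b}} \<le> max_matching_weight n (arrival_weight C [0..<n] ys)"
    unfolding max_matching_weight_def by (intro Max_ge) blast+
  thus ?thesis using w by simp
qed

section \<open>Randomized algorithms averaged over seeds and vertex orders\<close>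

locale fixed_algorithm =
  fixes R :: "'r measure" and A :: "nat \<Rightarrow> 'r \<Rightarrow> decision_rule"
  assumes alg: "online_algorithm R A"
begin

sublocale R: prob_space R
  using alg by (simp add: online_algorithm_def)

lemma measurable_online_matching:
  "(\<lambda>r. online_matching (A n r) w vs t) \<in> measurable R (count_space UNIV)"
proof (induction t)
  case (Suc t)
  define d where "d r = A n r (take (Suc t) vs) (revealed w (take (Suc t) vs))" for r
  define nxt where "nxt i M = (case i of None \<Rightarrow> M
    | Some u \<Rightarrow> if u \<in> set (take t vs) - \<Union>M then insert {u, vs ! t} M else M)" for i and M :: "nat set set"
  have "(\<lambda>r. nxt (d r) (online_matching (A n r) w vs t)) \<in> measurable R (count_space UNIV)"
  \<comment> \<open>The case split is over the decision, which has a countable type, and not over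
    the matching, whose type is uncountable.\<close>
  proof (rule measurable_compose_countable[where g=d and f="\<lambda>i r. nxt i (online_matching (A n r) w vs t)"])
    show "d \<in> measurable R (count_space UNIV)"
      using alg unfolding online_algorithm_def d_def[abs_def] by blast
    show "(\<lambda>r. nxt i (online_matching (A n r) w vs t)) \<in> measurable R (count_space UNIV)" for i
      by (rule measurable_compose[OF Suc]) simp
  qed
  thus ?case by (simp add: d_def nxt_def Let_def)
qed simp

lemma integrable_online_matching:
  fixes \<phi> :: "nat set set \<Rightarrow> real"
  assumes "\<And>r. \<bar>\<phi> (online_matching (A n r) w vs t)\<bar> \<le> B"
  shows "integrable R (\<lambda>r. \<phi> (online_matching (A n r) w vs t))"
  by (rule R.integrable_const_bound[where B=B])
     (use assms in \<open>auto intro!: measurable_compose[OF measurable_online_matching]\<close>)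

lemma integrable_top_free: "integrable R (\<lambda>r. of_bool (top_free (A n r) C vs ys) :: real)"
  unfolding top_free_def
  by (rule integrable_online_matching[of "\<lambda>M. of_bool (\<exists>i<length ys. ys ! i = largest (set ys) \<and> vs ! i \<notin> \<Union>M)" _ _ _ _ 1]) simp

lemma integrable_top_two_matched:
  "integrable R (\<lambda>r. of_bool (top_two_matched (A n r) C vs ys) :: real)"
  unfolding top_two_matched_def
  by (rule integrable_online_matching[of "\<lambda>M. of_bool (\<exists>i<length ys. \<exists>j<length ys.
     ys ! i = largest (set ys) \<and> ys ! j = second_largest (set ys) \<and> {vs ! i, vs ! j} \<in> M)" _ _ _ _ 1]) simp

definition arrival_average :: "nat \<Rightarrow> (nat list \<Rightarrow> 'r \<Rightarrow> real) \<Rightarrow> real" where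
  "arrival_average n f = perm_average (\<lambda>vs. \<integral>r. f vs r \<partial>R) {..<n}"

lemma arrival_average_mono:
  assumes "\<And>vs. integrable R (f vs)" "\<And>vs. integrable R (g vs)"
    and "\<And>vs r. vs \<in> permutations_of_set {..<n} \<Longrightarrow> f vs r \<le> g vs r"
  shows "arrival_average n f \<le> arrival_average n g"
  unfolding arrival_average_def using assms by (intro perm_average_mono integral_mono) auto

lemma arrival_average_add:
  assumes "\<And>vs. integrable R (f vs)" "\<And>vs. integrable R (g vs)"
  shows "arrival_average n (\<lambda>vs r. f vs r + g vs r) = arrival_average n f + arrival_average n g"
  unfolding arrival_average_def using assms by (simp add: perm_average_add)

lemma arrival_average_const: "arrival_average n (\<lambda>_ _. c) = c"
  by (simp add: arrival_average_def perm_average_const R.prob_space)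

text \<open>Vertex names and seed are averaged out, so that only the sequence of values remains;
  this is what makes Ramsey's theorem on sets of values applicable.\<close>

definition prob_top_free :: "nat \<Rightarrow> real \<Rightarrow> nat list \<Rightarrow> real" where
  "prob_top_free n C ys = arrival_average n (\<lambda>vs r. of_bool (top_free (A n r) C vs ys))"

definition prob_top_two_matched :: "nat \<Rightarrow> real \<Rightarrow> nat list \<Rightarrow> real" where
  "prob_top_two_matched n C ys = arrival_average n (\<lambda>vs r. of_bool (top_two_matched (A n r) C vs ys))"

text \<open>Each game axiom holds as an implication or exclusion between events for every fixed
  vertex order and seed, and is then integrated.\<close>

lemma top_two_game: "top_two_game n (prob_top_free n C) (prob_top_two_matched n C)"
proof -
  note int = integrable_top_free integrable_top_two_matched
  have bounds: "0 \<le> arrival_average n (\<lambda>vs r. of_bool (P vs r))"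
      "arrival_average n (\<lambda>vs r. of_bool (P vs r)) \<le> 1"
    if "\<And>vs. integrable R (\<lambda>r. of_bool (P vs r) :: real)" for P
    using arrival_average_mono[of "\<lambda>_ _. 0" "\<lambda>vs r. of_bool (P vs r)" n]
      arrival_average_mono[of "\<lambda>vs r. of_bool (P vs r)" "\<lambda>_ _. 1" n] that
    by (auto simp: arrival_average_const)
  have vs: "distinct vs" "length vs = n" if "vs \<in> permutations_of_set {..<n}" for vs
    using that distinct_card[of vs] by (auto simp: permutations_of_set_def)
  have le: "arrival_average n (\<lambda>vs r. of_bool (P vs r)) \<le> arrival_average n (\<lambda>vs r. of_bool (Q vs r))"
    if "\<And>vs. integrable R (\<lambda>r. of_bool (P vs r) :: real)" "\<And>vs. integrable R (\<lambda>r. of_bool (Q vs r) :: real)"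
      "\<And>vs r. distinct vs \<Longrightarrow> length vs = n \<Longrightarrow> P vs r \<Longrightarrow> Q vs r" for P Q
    using that vs by (intro arrival_average_mono) auto
  \<comment> \<open>Two disjoint events inside a third one; the bound 1 for a new record arises by
    taking the third event to be \<open>True\<close>.\<close>
  have sum_le: "arrival_average n (\<lambda>vs r. of_bool (P vs r)) + arrival_average n (\<lambda>vs r. of_bool (Q vs r))
      \<le> arrival_average n (\<lambda>vs r. of_bool (P' vs r))"
    if i: "\<And>vs. integrable R (\<lambda>r. of_bool (P vs r) :: real)" "\<And>vs. integrable R (\<lambda>r. of_bool (Q vs r) :: real)"
      "\<And>vs. integrable R (\<lambda>r. of_bool (P' vs r) :: real)"
      and imp: "\<And>vs r. distinct vs \<Longrightarrow> length vs = n \<Longrightarrow> (P vs r \<longrightarrow> P' vs r) \<and> (Q vs r \<longrightarrow> P' vs r) \<and> \<not> (Q vs r \<and> P vs r)"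
    for P Q P'
  proof -
    have "arrival_average n (\<lambda>vs r. of_bool (P vs r) + of_bool (Q vs r)) \<le>
        arrival_average n (\<lambda>vs r. of_bool (P' vs r))"
    proof (rule arrival_average_mono)
      fix vs r assume "vs \<in> permutations_of_set {..<n}"
      from imp[OF vs[OF this], of r]
      show "of_bool (P vs r) + of_bool (Q vs r) \<le> (of_bool (P' vs r) :: real)" by auto
    qed (use i in auto)
    thus ?thesis using arrival_average_add[OF i(1,2)] by simp
  qed
  have one: "integrable R (\<lambda>r. of_bool True :: real)" by simp
  have avg1: "arrival_average n (\<lambda>vs r. of_bool True) = 1" by (simp add: arrival_average_const)
  show ?thesis
  proof
    fix ys
    show "0 \<le> prob_top_free n C ys" "prob_top_free n C ys \<le> 1"
      "0 \<le> prob_top_two_matched n C ys" "prob_top_two_matched n C ys \<le> 1"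
      unfolding prob_top_free_def prob_top_two_matched_def by (intro bounds int)+
  next
    fix zs x assume *: "distinct (zs @ [x])" "zs \<noteq> []" "length zs < n" "x = largest (set (zs @ [x]))"
    have "prob_top_free n C (zs @ [x]) + prob_top_two_matched n C (zs @ [x]) \<le> arrival_average n (\<lambda>vs r. of_bool True)"
      unfolding prob_top_free_def prob_top_two_matched_def
      by (rule sum_le[OF int one]) (use top_two_snoc_largest(2)[OF _ _ *(1,2,4)] *(3) in blast)
    moreover have "prob_top_two_matched n C (zs @ [x]) \<le> prob_top_free n C zs"
      unfolding prob_top_free_def prob_top_two_matched_def
      by (rule le[OF int(2,1)]) (use top_two_snoc_largest(1)[OF _ _ *(1,2,4)] *(3) in blast)
    ultimately show "prob_top_free n C (zs @ [x]) + prob_top_two_matched n C (zs @ [x]) \<le> 1 \<and>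
      prob_top_two_matched n C (zs @ [x]) \<le> prob_top_free n C zs" unfolding avg1 by simp
  next
    fix zs x assume *: "distinct (zs @ [x])" "zs \<noteq> []" "length zs < n" "x = second_largest (set (zs @ [x]))"
    \<comment> \<open>\<open>largest_snoc\<close> was proved relative to some vertex order longer
      than \<open>zs\<close>; \<open>[0..<n]\<close> is an arbitrary choice.\<close>
    have x: "x \<noteq> largest (set (zs @ [x]))"
      using largest_snoc(3)[of "[0..<n]" zs x] * by simp
    show "prob_top_free n C (zs @ [x]) + prob_top_two_matched n C (zs @ [x]) \<le> prob_top_free n C zs"
      unfolding prob_top_free_def prob_top_two_matched_def
    proof (rule sum_le[OF int int(1)], intro conjI impI)
      fix vs :: "nat list" and r assume v: "distinct vs" "length vs = n"
      hence l: "length zs < length vs" using * by simp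
      show "top_free (A n r) C vs (zs @ [x]) \<Longrightarrow> top_free (A n r) C vs zs"
        by (rule top_free_snoc[OF v(1) l *(1,2) x])
      show "top_two_matched (A n r) C vs (zs @ [x]) \<Longrightarrow> top_free (A n r) C vs zs"
        by (rule top_two_snoc_second(1)[OF v(1) l *(1,2,4)])
      show "\<not> (top_two_matched (A n r) C vs (zs @ [x]) \<and> top_free (A n r) C vs (zs @ [x]))"
        by (rule top_two_snoc_second(2)[OF v(1) l *(1,2,4)])
    qed
  next
    fix zs x assume *: "distinct (zs @ [x])" "zs \<noteq> []" "length zs < n"
      and x: "x \<notin> {largest (set (zs @ [x])), second_largest (set (zs @ [x]))}"
    have x': "x \<noteq> largest (set (zs @ [x]))" "x \<noteq> second_largest (set (zs @ [x]))" using x by auto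
    have "prob_top_free n C (zs @ [x]) \<le> prob_top_free n C zs"
      unfolding prob_top_free_def
    proof (rule le[OF int(1,1)])
      fix vs :: "nat list" and r assume v: "distinct vs" "length vs = n"
      hence l: "length zs < length vs" using * by simp
      show "top_free (A n r) C vs (zs @ [x]) \<Longrightarrow> top_free (A n r) C vs zs"
        by (rule top_free_snoc[OF v(1) l *(1,2) x'(1)])
    qed
    moreover have "prob_top_two_matched n C (zs @ [x]) \<le> prob_top_two_matched n C zs"
      unfolding prob_top_two_matched_def
    proof (rule le[OF int(2,2)])
      fix vs :: "nat list" and r assume v: "distinct vs" "length vs = n"
      hence l: "length zs < length vs" using * by simp
      show "top_two_matched (A n r) C vs (zs @ [x]) \<Longrightarrow> top_two_matched (A n r) C vs zs"
        by (rule top_two_snoc_other[OF v(1) l *(1,2) x'])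
    qed
    ultimately show "prob_top_free n C (zs @ [x]) \<le> prob_top_free n C zs \<and>
      prob_top_two_matched n C (zs @ [x]) \<le> prob_top_two_matched n C zs" by simp
  qed
qed

lemma expected_weight_eq:
  "expected_weight R A n w = arrival_average n (\<lambda>vs r. sum w (online_matching (A n r) w vs n))"
  unfolding expected_weight_def arrival_average_def perm_average_def
  by (subst integral_pmf_of_set) auto

text \<open>Double counting over labellings \<open>ys\<close> and vertex orders \<open>vs\<close>:
  after exchanging the sums, \<open>sum_permutations_relabel\<close> replaces the values in order of
  arrival by a free permutation of \<open>S\<close>, and \<open>sum_arrival_weight_le\<close>
  applies to each run.\<close>

lemma sum_expected_weight_le:
  assumes S: "finite S" "card S = n" "n \<ge> 2" and C: "C \<ge> 1"
  shows "(\<Sum>ys\<in>permutations_of_set S. expected_weight R A n (arrival_weight C [0..<n] ys)) \<le>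
    fact n * (C ^ (largest S + second_largest S) * (perm_average (prob_top_two_matched n C) S + real n / C))"
proof -
  define s where "s = largest S + second_largest S"
  define I where "I vs ys = (\<integral>r. sum (arrival_weight C vs ys) (online_matching (A n r) (arrival_weight C vs ys) vs n) \<partial>R)"
    for vs ys
  define J where "J vs ys = (\<integral>r. of_bool (top_two_matched (A n r) C vs ys) \<partial>R :: real)" for vs ys
  have ys: "length ys = n" if "ys \<in> permutations_of_set S" for ys
    using that S distinct_card[of ys] by (auto simp: permutations_of_set_def)
  have vs: "distinct vs" "length vs = n" if "vs \<in> permutations_of_set {..<n}" for vs
    using that distinct_card[of vs] by (auto simp: permutations_of_set_def)
  have I_le: "I vs ys \<le> C ^ s * (J vs ys + real n / C)"
    if "vs \<in> permutations_of_set {..<n}" "ys \<in> permutations_of_set S" for vs ys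
  proof -
    let ?w = "arrival_weight C vs ys"
    have le: "sum ?w (online_matching (A n r) ?w vs n) \<le> C ^ s * (of_bool (top_two_matched (A n r) C vs ys) + real n / C)" for r
      unfolding s_def using sum_arrival_weight_le[OF vs[OF that(1)] that(2) S C] by simp
    have pos: "0 \<le> sum ?w (online_matching (A n r) ?w vs n)" for r
      using C by (intro sum_nonneg) (simp add: arrival_weight_def)
    have "\<bar>sum ?w (online_matching (A n r) ?w vs n)\<bar> \<le> C ^ s * (1 + real n / C)" for r
    proof -
      have "C ^ s * (of_bool (top_two_matched (A n r) C vs ys) + real n / C) \<le> C ^ s * (1 + real n / C)"
        using C by (intro mult_left_mono) auto
      thus ?thesis using le[of r] pos[of r] by linarith
    qed
    hence "integrable R (\<lambda>r. sum ?w (online_matching (A n r) ?w vs n))"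
      by (rule integrable_online_matching)
    hence "I vs ys \<le> (\<integral>r. C ^ s * (of_bool (top_two_matched (A n r) C vs ys) + real n / C) \<partial>R)"
      unfolding I_def using le integrable_top_two_matched by (intro integral_mono) auto
    also have "\<dots> = C ^ s * (J vs ys + real n / C)"
      unfolding J_def using integrable_top_two_matched by (simp add: R.prob_space)
    finally show ?thesis .
  qed
  have "(\<Sum>ys\<in>permutations_of_set S. expected_weight R A n (arrival_weight C [0..<n] ys)) =
    (\<Sum>ys\<in>permutations_of_set S. (\<Sum>vs\<in>permutations_of_set {..<n}. I vs (map ((!) ys) vs)) / fact n)"
    unfolding expected_weight_eq arrival_average_def perm_average_def I_def
    by (intro sum.cong arg_cong2[where f="(/)"] refl) (simp_all add: arrival_weight_relabel ys)
  also have "\<dots> = (\<Sum>vs\<in>permutations_of_set {..<n}. \<Sum>ys\<in>permutations_of_set S. I vs (map ((!) ys) vs)) / fact n"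
    by (subst sum.swap) (simp add: sum_divide_distrib)
  also have "\<dots> = (\<Sum>vs\<in>permutations_of_set {..<n}. \<Sum>ys\<in>permutations_of_set S. I vs ys) / fact n"
    using S by (intro arg_cong2[where f="(/)"] sum.cong refl sum_permutations_relabel) simp
  also have "\<dots> \<le> (\<Sum>vs\<in>permutations_of_set {..<n}. \<Sum>ys\<in>permutations_of_set S. C ^ s * (J vs ys + real n / C)) / fact n"
    by (intro divide_right_mono sum_mono I_le) auto
  also have "\<dots> = (\<Sum>ys\<in>permutations_of_set S. \<Sum>vs\<in>permutations_of_set {..<n}. C ^ s * (J vs ys + real n / C)) / fact n"
    by (subst sum.swap) simp
  also have "\<dots> = (\<Sum>ys\<in>permutations_of_set S. C ^ s * (prob_top_two_matched n C ys + real n / C))"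
    unfolding sum_divide_distrib[of _ "permutations_of_set S"]
  proof (intro sum.cong refl)
    fix ys
    have dist: "c * (a + f * b) / f = c * (a / f + b)" if "f \<noteq> 0" for a b c f :: real
      using that by (simp add: field_simps)
    have eq: "(\<Sum>vs\<in>permutations_of_set {..<n}. C ^ s * (J vs ys + real n / C)) =
        C ^ s * ((\<Sum>vs\<in>permutations_of_set {..<n}. J vs ys) + fact n * (real n / C))"
      by (simp add: sum_distrib_left[symmetric] sum.distrib)
    have prob: "prob_top_two_matched n C ys = (\<Sum>vs\<in>permutations_of_set {..<n}. J vs ys) / fact n"
      by (simp add: prob_top_two_matched_def arrival_average_def perm_average_def J_def)
    show "(\<Sum>vs\<in>permutations_of_set {..<n}. C ^ s * (J vs ys + real n / C)) / fact n =
        C ^ s * (prob_top_two_matched n C ys + real n / C)"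
      unfolding eq prob by (rule dist) simp
  qed
  also have "\<dots> = fact n * (C ^ s * (perm_average (prob_top_two_matched n C) S + real n / C))"
    using S by (simp add: sum_distrib_left[symmetric] sum.distrib perm_average_def distrib_left)
  finally show ?thesis unfolding s_def .
qed

text \<open>The instance is not explicit: some labelling of the vertices by the homogeneous set is
  at least as bad as the average labelling.\<close>

lemma exists_hard_instance:
  assumes "\<epsilon> > 0"
  shows "\<exists>n w. (\<forall>e\<in>complete_edges n. w e \<ge> 0) \<and>
           expected_weight R A n w < (5 / 12 + \<epsilon>) * max_matching_weight n w"
proof -
  \<comment> \<open>\<open>m\<close> gives \<open>real n - 1 > 1 / \<epsilon>\<close>,
    \<open>C\<close> gives \<open>n / C < \<epsilon> / 2\<close>, and \<open>\<delta>\<close> gives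
    \<open>2 * n^3 * \<delta> = 1 / 4\<close>. It matters that \<open>C\<close> is fixed before the
    values are chosen, since the probabilities to which Ramsey's theorem is applied depend on
    \<open>C\<close>.\<close>
  obtain m :: nat where m: "real m > max 2 (2 / \<epsilon>)" using reals_Archimedean2 by blast
  define n where "n = 2 * m"
  define C where "C = 1 + 3 * real n / \<epsilon>"
  define \<delta> where "\<delta> = 1 / (8 * real n ^ 3)"
  have m2: "m \<ge> 2" using m by simp
  hence n: "n \<ge> 2" "real n > 0" by (auto simp: n_def)
  have C: "C \<ge> 1" using \<open>\<epsilon> > 0\<close> by (simp add: C_def)
  have \<delta>: "\<delta> > 0" using n by (simp add: \<delta>_def)
  interpret top_two_game n "prob_top_free n C" "prob_top_two_matched n C"
    by (rule top_two_game)
  have F01: "0 \<le> perm_average (prob_top_free n C) T" "perm_average (prob_top_free n C) T \<le> 1"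
      "0 \<le> perm_average G T" "perm_average G T \<le> 1" for T
  proof -
    \<comment> \<open>Bounds for all \<open>T\<close> are required by
      \<open>Ramsey_almost_constant\<close>; an infinite set has no permutations, so its average is
      0.\<close>
    have "0 \<le> perm_average f T \<and> perm_average f T \<le> 1" if "\<And>ys. 0 \<le> f ys \<and> f ys \<le> 1" for f
    proof (cases "finite T")
      case True
      thus ?thesis using perm_average_mono[of T "\<lambda>_. 0" f] perm_average_mono[of T f "\<lambda>_. 1"] that
        by (simp add: perm_average_const)
    qed (simp add: perm_average_def permutations_of_set_infinite)
    thus "0 \<le> perm_average (prob_top_free n C) T" "perm_average (prob_top_free n C) T \<le> 1"
      "0 \<le> perm_average G T" "perm_average G T \<le> 1"
      using F_nonneg F_le_1 G_bounds by simp_all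
  qed
  obtain Y k where Y: "infinite Y" and k: "\<forall>t\<le>n. 0 \<le> k t \<and> (\<forall>T\<subseteq>Y. finite T \<and> card T = t \<longrightarrow>
      k t \<le> perm_average (prob_top_free n C) T \<and> perm_average (prob_top_free n C) T \<le> k t + \<delta>)"
    using Ramsey_almost_constant[where f="perm_average (prob_top_free n C)" and n=n, OF infinite_UNIV_nat \<delta> F01(1,2)]
    by (elim exE conjE)
  \<comment> \<open>The second application of Ramsey's theorem takes place inside \<open>Y\<close>,
    so the homogeneity for \<open>prob_top_free\<close> is inherited by \<open>Y'\<close>.\<close>
  obtain Y' h where Y': "Y' \<subseteq> Y" "infinite Y'" and h: "\<forall>t\<le>n. 0 \<le> h t \<and> (\<forall>T\<subseteq>Y'. finite T \<and> card T = t \<longrightarrow>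
      h t \<le> perm_average G T \<and> perm_average G T \<le> h t + \<delta>)"
    using Ramsey_almost_constant[where f="perm_average G" and n=n, OF Y \<delta> F01(3,4)]
    by (elim exE conjE)
  obtain S where S: "finite S" "card S = n" "S \<subseteq> Y'"
    using infinite_arbitrarily_large[OF Y'(2), of n] by blast
  have fin: "finite T" if "T \<subseteq> S" for T using that S(1) by (rule finite_subset)
  have "perm_average (prob_top_two_matched n C) S \<le> 5 / 12 + (1 / 4 + 2 * real n ^ 3 * \<delta>) / (real n - 1)"
  proof (rule average_W_le_on_homogeneous_set[where m=m and k=k and h=h])
    fix t T assume T: "t \<le> n" "T \<subseteq> S" "card T = t"
    have "T \<subseteq> Y'" "T \<subseteq> Y" "finite T" using T S Y' fin by auto
    thus "k t \<le> perm_average (prob_top_free n C) T \<and> perm_average (prob_top_free n C) T \<le> k t + \<delta>"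
      "h t \<le> perm_average G T \<and> perm_average G T \<le> h t + \<delta>"
      using k h T by simp_all
  qed (use m2 S \<delta> k h in \<open>simp_all add: n_def\<close>)
  also have "2 * real n ^ 3 * \<delta> = 1 / 4" using n by (simp add: \<delta>_def)
  also have "(1 / 4 + 1 / 4) / (real n - 1) \<le> \<epsilon> / 2"
  proof -
    have "1 / \<epsilon> < real n - 1" using m by (simp add: n_def)
    thus ?thesis using \<open>\<epsilon> > 0\<close> n by (simp add: field_simps)
  qed
  finally have avg: "perm_average (prob_top_two_matched n C) S \<le> 5 / 12 + \<epsilon> / 2" by simp
  have "real n / C < \<epsilon> / 2"
    using \<open>\<epsilon> > 0\<close> n by (simp add: C_def field_simps add_pos_pos)
  with avg have lt: "perm_average (prob_top_two_matched n C) S + real n / C < 5 / 12 + \<epsilon>" by simp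
  define W where "W = C ^ (largest S + second_largest S)"
  have "W > 0" using C by (simp add: W_def)
  have "(\<Sum>ys\<in>permutations_of_set S. expected_weight R A n (arrival_weight C [0..<n] ys)) \<le>
      fact n * (W * (perm_average (prob_top_two_matched n C) S + real n / C))"
    using sum_expected_weight_le[OF S(1,2) n(1) C] by (simp add: W_def)
  also have "\<dots> < fact n * (W * (5 / 12 + \<epsilon>))"
    using lt \<open>W > 0\<close> by simp
  also have "\<dots> = (\<Sum>ys\<in>permutations_of_set S. W * (5 / 12 + \<epsilon>))"
    using S by simp
  \<comment> \<open>If every labelling reached \<open>W * (5 / 12 + \<epsilon>)\<close>, so would
    the sum.\<close>
  finally have "\<exists>ys\<in>permutations_of_set S.
      expected_weight R A n (arrival_weight C [0..<n] ys) < W * (5 / 12 + \<epsilon>)"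
    using sum_mono[of "permutations_of_set S" "\<lambda>_. W * (5 / 12 + \<epsilon>)"
        "\<lambda>ys. expected_weight R A n (arrival_weight C [0..<n] ys)"] by (meson not_le)
  then obtain ys where ys: "ys \<in> permutations_of_set S"
    and less: "expected_weight R A n (arrival_weight C [0..<n] ys) < W * (5 / 12 + \<epsilon>)" by blast
  have "W * (5 / 12 + \<epsilon>) \<le> (5 / 12 + \<epsilon>) * max_matching_weight n (arrival_weight C [0..<n] ys)"
    using power_le_max_matching_weight[OF ys S(1,2) n(1), of C] \<open>\<epsilon> > 0\<close>
    by (subst mult.commute, intro mult_left_mono) (auto simp: W_def)
  with less have "expected_weight R A n (arrival_weight C [0..<n] ys) <
      (5 / 12 + \<epsilon>) * max_matching_weight n (arrival_weight C [0..<n] ys)" by simp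
  moreover have "\<forall>e\<in>complete_edges n. 0 \<le> arrival_weight C [0..<n] ys e"
    using C by (simp add: arrival_weight_def)
  ultimately show ?thesis by blast
qed

end

theorem theorem3:
  fixes R :: "'r measure"
    and A :: "nat \<Rightarrow> 'r \<Rightarrow> decision_rule"
    and \<epsilon> :: real
  assumes "online_algorithm R A"
    and "\<epsilon> > 0"
  shows "\<exists>(n :: nat) (w :: nat set \<Rightarrow> real).
           (\<forall>e\<in>complete_edges n. w e \<ge> 0) \<and>
           expected_weight R A n w < (5 / 12 + \<epsilon>) * max_matching_weight n w"
  using fixed_algorithm.exists_hard_instance[OF fixed_algorithm.intro[OF assms(1)] assms(2)] .

end
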